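(* Let $\widetilde{\widetilde{p}}_A=\widetilde{\widetilde{p}}_A(g_1,g_2,g_3,\dots)$ be the formal power series $$\widetilde{\widetilde{p}}_A:=1+\sum_{\mathcal{T}}\frac{1}{|\mathrm{Aut}(\mathcal{T})|}\prod_v g_{l(v)}^{|\mathrm{out}(v)|-1},$$ where $\mathcal{T}$ runs over the minimal representatives (isomorphism classes of levelled oriented trees without trivial tails) on $n\ge 2$ leaves, and $v$ runs over the non-leaf vertices of $\mathcal{T}$. Let $\widetilde{\widetilde{p}}_A[1]:=\widetilde{\widetilde{p}}_A(g_2,g_3,g_4,\dots)$ be the series obtained by substituting $g_{i+1}$ for $g_i$ for all $i\ge1$. Then the following recursive formula holds: $$\widetilde{\widetilde{p}}_A=\frac{e^{g_1\,\widetilde{\widetilde{p}}_A[1]}-1}{g_1}.$$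
   Context: A levelled oriented tree is a finite rooted tree (non-planar, leaves unlabelled), with edges directed away from the root. Leaves are the vertices without outgoing edges. A non-leaf vertex $v$ has level $l(v)=1+$ (distance from $v$ to the root), so the root has level $1$. $\mathrm{out}(v)$ is the set of outgoing edges of $v$; $\mathrm{Aut}(\mathcal{T})$ is the group of automorphisms of $\mathcal{T}$ as a rooted oriented tree. A trivial tail is a subtree stemming from a (non-leaf) vertex $v$ with $|\mathrm{out}(v)|=1$ and having a single leaf. Two trees are equivalent if they differ only by trivial tails (i.e. by replacing such subtrees with a single leaf, or conversely); the minimal representative of an equivalence class is the tree in it with no trivial tails (equivalently, every non-leaf vertex has at least two leaves among its descendants; non-leaf vertices with exactly one outgoing edge are allowed otherwise). The series are formal power series with rational coefficients in the infinitely many variables $g_1,g_2,\dots$ (infinitely many monomials of a given degree may occur). *)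

theory Defs
  imports Complex_Main "HOL-Library.Multiset" "HOL-Combinatorics.Permutations"
begin

section \<open>Formal power series in arbitrarily many variables\<close>

text \<open>
  A monomial is the multiset of its variables (with multiplicity), and a series is an arbitrary
  function from monomials to coefficients.  There may be infinitely many variables, and infinitely
  many monomials of a given degree may have a nonzero coefficient.
\<close>

typedef ('v, 'a) mfps = "UNIV :: ('v multiset \<Rightarrow> 'a) set"
  morphisms mcoeff Abs_mfps
  by simp

lemma mfps_eqI: "(\<And>m. mcoeff f m = mcoeff g m) \<Longrightarrow> f = g"
  by (simp add: mcoeff_inject[symmetric] fun_eq_iff)

lemma mcoeff_Abs [simp]: "mcoeff (Abs_mfps f) = f"
  by (simp add: Abs_mfps_inverse)

lemma finite_submultisets: "finite {a. a \<subseteq># (m :: 'v multiset)}"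
proof (induction m)
  case empty
  show ?case by simp
next
  case (add x m)
  have "a \<in> {a. a \<subseteq># m} \<union> add_mset x ` {a. a \<subseteq># m}" if "a \<subseteq># add_mset x m" for a
  proof (cases "x \<in># a")
    case True
    then obtain b where "a = add_mset x b" by (rule mset_add)
    with that show ?thesis by auto
  next
    case False
    with that show ?thesis by (auto simp: subseteq_mset_def count_eq_zero_iff split: if_splits)
         (metis count_add_mset count_eq_zero_iff le0)
  qed
  then have "{a. a \<subseteq># add_mset x m} \<subseteq> {a. a \<subseteq># m} \<union> add_mset x ` {a. a \<subseteq># m}"
    by blast
  with add.IH show ?case by (meson finite_UnI finite_imageI finite_subset)
qed

lemma finite_factorizations: "finite {(a, b). a + b = (m :: 'v multiset)}"
proof (rule finite_subset)
  show "{(a, b). a + b = m} \<subseteq> {a. a \<subseteq># m} \<times> {a. a \<subseteq># m}" by auto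
  show "finite ({a. a \<subseteq># m} \<times> {a. a \<subseteq># m})" by (simp add: finite_submultisets)
qed

instantiation mfps :: (type, comm_ring_1) comm_ring_1
begin

definition "0 = Abs_mfps (\<lambda>m. 0)"

definition "1 = Abs_mfps (\<lambda>m. if m = {#} then 1 else 0)"

definition "f + g = Abs_mfps (\<lambda>m. mcoeff f m + mcoeff g m)"

definition "f - g = Abs_mfps (\<lambda>m. mcoeff f m - mcoeff g m)"

definition "- f = Abs_mfps (\<lambda>m. - mcoeff f m)"

definition "f * g = Abs_mfps (\<lambda>m. \<Sum>(a, b) \<in> {(a, b). a + b = m}. mcoeff f a * mcoeff g b)"

instance
proof
  fix f g h :: "('a, 'b) mfps"
  show "f * g * h = f * (g * h)"
  proof (rule mfps_eqI)
    fix m :: "'a multiset"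
    let ?S = "{(a, b, c). a + b + c = m}"
    have "mcoeff (f * g * h) m =
        (\<Sum>(d, c) \<in> {(d, c). d + c = m}. \<Sum>(a, b) \<in> {(a, b). a + b = d}.
           mcoeff f a * mcoeff g b * mcoeff h c)"
      by (simp add: times_mfps_def sum_distrib_right case_prod_unfold)
    also have "\<dots> = (\<Sum>((d, c), (a, b)) \<in> (SIGMA x:{(d, c). d + c = m}. {(a, b). a + b = fst x}).
           mcoeff f a * mcoeff g b * mcoeff h c)"
      by (subst sum.Sigma[symmetric])
         (auto simp: finite_factorizations[unfolded case_prod_unfold] case_prod_unfold)
    also have "\<dots> = (\<Sum>(a, b, c) \<in> ?S. mcoeff f a * mcoeff g b * mcoeff h c)"
      by (rule sum.reindex_bij_witness[where i = "\<lambda>(a, b, c). ((a + b, c), (a, b))"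
            and j = "\<lambda>((d, c), (a, b)). (a, b, c)"]) auto
    also have "\<dots> = (\<Sum>((a, d), (b, c)) \<in> (SIGMA x:{(a, d). a + d = m}. {(b, c). b + c = snd x}).
           mcoeff f a * mcoeff g b * mcoeff h c)"
      by (rule sum.reindex_bij_witness[where j = "\<lambda>(a, b, c). ((a, b + c), (b, c))"
            and i = "\<lambda>((a, d), (b, c)). (a, b, c)"]) (auto simp: ac_simps)
    also have "\<dots> = (\<Sum>(a, d) \<in> {(a, d). a + d = m}. \<Sum>(b, c) \<in> {(b, c). b + c = d}.
           mcoeff f a * mcoeff g b * mcoeff h c)"
      by (subst sum.Sigma[symmetric])
         (auto simp: finite_factorizations[unfolded case_prod_unfold] case_prod_unfold)
    also have "\<dots> = mcoeff (f * (g * h)) m"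
      by (simp add: times_mfps_def sum_distrib_left case_prod_unfold mult.assoc)
    finally show "mcoeff (f * g * h) m = mcoeff (f * (g * h)) m" .
  qed
  show "f * g = g * f"
  proof (rule mfps_eqI)
    fix m :: "'a multiset"
    show "mcoeff (f * g) m = mcoeff (g * f) m"
      unfolding times_mfps_def mcoeff_Abs
      by (rule sum.reindex_bij_witness[where i = prod.swap and j = prod.swap])
         (auto simp: ac_simps)
  qed
  show "1 * f = f"
  proof (rule mfps_eqI)
    fix m :: "'a multiset"
    have "mcoeff (1 * f) m = (\<Sum>(a, b) \<in> {({#}, m)}. mcoeff 1 a * mcoeff f b)"
      unfolding times_mfps_def mcoeff_Abs
      by (rule sum.mono_neutral_right) (auto simp: finite_factorizations one_mfps_def split: if_splits)
    then show "mcoeff (1 * f) m = mcoeff f m" by (simp add: one_mfps_def)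
  qed
  show "(f + g) * h = f * h + g * h"
    by (rule mfps_eqI)
       (simp add: times_mfps_def plus_mfps_def case_prod_unfold distrib_right sum.distrib)
  show "(0 :: ('a, 'b) mfps) \<noteq> 1"
  proof
    assume "(0 :: ('a, 'b) mfps) = 1"
    then have "mcoeff (0 :: ('a, 'b) mfps) {#} = mcoeff 1 {#}" by simp
    then show False by (simp add: zero_mfps_def one_mfps_def)
  qed
qed (auto intro!: mfps_eqI simp: plus_mfps_def zero_mfps_def minus_mfps_def uminus_mfps_def)

end

definition mfps_const :: "'a::comm_ring_1 \<Rightarrow> ('v, 'a) mfps" where
  "mfps_const c = Abs_mfps (\<lambda>m. if m = {#} then c else 0)"

definition mfps_var :: "'v \<Rightarrow> ('v, 'a::comm_ring_1) mfps" where
  "mfps_var i = Abs_mfps (\<lambda>m. if m = {#i#} then 1 else 0)"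

text \<open>
  The coefficientwise sum of a family of series.  It is meaningful for locally finite families,
  i.e. those in which each monomial has a nonzero coefficient in only finitely many members.
\<close>

definition mfps_sum :: "('i \<Rightarrow> ('v, 'a::comm_ring_1) mfps) \<Rightarrow> 'i set \<Rightarrow> ('v, 'a) mfps" where
  "mfps_sum f I = Abs_mfps (\<lambda>m. \<Sum>i \<in> {i \<in> I. mcoeff (f i) m \<noteq> 0}. mcoeff (f i) m)"

text \<open>The exponential is meaningful for series without constant term.\<close>

definition mfps_exp :: "('v, 'a::field_char_0) mfps \<Rightarrow> ('v, 'a) mfps" where
  "mfps_exp f = mfps_sum (\<lambda>k. mfps_const (1 / fact k) * f ^ k) (UNIV :: nat set)"

text \<open>
  Substitution of the variable with index \<open>\<sigma> i\<close> for the variable with index \<open>i\<close>, for all \<open>i\<close>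
  simultaneously; the sum is finite whenever \<open>\<sigma>\<close> is injective.
\<close>

definition mfps_rename :: "('v \<Rightarrow> 'w) \<Rightarrow> ('v, 'a::comm_ring_1) mfps \<Rightarrow> ('w, 'a) mfps" where
  "mfps_rename \<sigma> f = Abs_mfps (\<lambda>m. \<Sum>m' \<in> {m'. image_mset \<sigma> m' = m}. mcoeff f m')"

text \<open>The exact quotient; it is meaningful when \<open>g\<close> divides \<open>f\<close> and is not a zero divisor.\<close>

definition mfps_quotient :: "('v, 'a::comm_ring_1) mfps \<Rightarrow> ('v, 'a) mfps \<Rightarrow> ('v, 'a) mfps" where
  "mfps_quotient f g = (THE q. f = g * q)"


section \<open>Levelled oriented trees\<close>

record 'n tree =
  vertices :: "'n set"
  edges :: "('n \<times> 'n) set"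
  tree_root :: 'n

text \<open>An edge \<open>(u, v)\<close> is directed from \<open>u\<close> to \<open>v\<close>, away from the root.\<close>

definition rooted_tree :: "'n tree \<Rightarrow> bool" where
  "rooted_tree T \<longleftrightarrow>
     finite (vertices T) \<and>
     tree_root T \<in> vertices T \<and>
     edges T \<subseteq> vertices T \<times> vertices T \<and>
     (\<forall>u. (u, tree_root T) \<notin> edges T) \<and>
     (\<forall>v \<in> vertices T - {tree_root T}. \<exists>!u. (u, v) \<in> edges T) \<and>
     (\<forall>v \<in> vertices T. (tree_root T, v) \<in> (edges T)\<^sup>*)"

definition out_edges :: "'n tree \<Rightarrow> 'n \<Rightarrow> ('n \<times> 'n) set" where
  "out_edges T v = {e \<in> edges T. fst e = v}"

definition leaves :: "'n tree \<Rightarrow> 'n set" where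
  "leaves T = {v \<in> vertices T. out_edges T v = {}}"

definition level :: "'n tree \<Rightarrow> 'n \<Rightarrow> nat" where
  "level T v = 1 + (LEAST k. (tree_root T, v) \<in> edges T ^^ k)"

definition is_tree_iso :: "('n \<Rightarrow> 'm) \<Rightarrow> 'n tree \<Rightarrow> 'm tree \<Rightarrow> bool" where
  "is_tree_iso f T T' \<longleftrightarrow>
     bij_betw f (vertices T) (vertices T') \<and>
     f (tree_root T) = tree_root T' \<and>
     (\<forall>u \<in> vertices T. \<forall>v \<in> vertices T. (u, v) \<in> edges T \<longleftrightarrow> (f u, f v) \<in> edges T')"

text \<open>
  Automorphisms are required to be the identity outside the vertex set, so that each automorphism
  is represented by exactly one function.
\<close>

definition tree_aut :: "'n tree \<Rightarrow> ('n \<Rightarrow> 'n) set" where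
  "tree_aut T = {f. f permutes vertices T \<and> is_tree_iso f T T}"

text \<open>The vertex \<open>v\<close> together with all its descendants spans a trivial tail.\<close>

definition trivial_tail_at :: "'n tree \<Rightarrow> 'n \<Rightarrow> bool" where
  "trivial_tail_at T v \<longleftrightarrow>
     v \<in> vertices T \<and> card (out_edges T v) = 1 \<and> card {w \<in> leaves T. (v, w) \<in> (edges T)\<^sup>*} = 1"

text \<open>Every finite tree is isomorphic to one whose vertices are natural numbers.\<close>

definition minimal_trees :: "nat tree set" where
  "minimal_trees = {T. rooted_tree T \<and> (\<nexists>v. trivial_tail_at T v) \<and> card (leaves T) \<ge> 2}"

definition minimal_tree_classes :: "nat tree set set" where
  "minimal_tree_classes =
     minimal_trees // {(T, T'). T \<in> minimal_trees \<and> T' \<in> minimal_trees \<and> (\<exists>f. is_tree_iso f T T')}"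

definition tree_term :: "'n tree \<Rightarrow> (nat, rat) mfps" where
  "tree_term T =
     mfps_const (1 / of_nat (card (tree_aut T))) *
     (\<Prod>v \<in> vertices T - leaves T. mfps_var (level T v) ^ (card (out_edges T v) - 1))"

text \<open>
  The variable \<open>g\<^sub>i\<close> is the one with index \<open>i\<close>; index 0 is not used.  The term of a tree depends
  only on its isomorphism class, so the choice of a representative is immaterial.  The family is
  locally finite: a monomial determines the number of leaves and, as trivial tails are excluded,
  bounds the height of the trees contributing to it.
\<close>

definition p_A :: "(nat, rat) mfps" where
  "p_A = 1 + mfps_sum (\<lambda>C. tree_term (SOME T. T \<in> C)) minimal_tree_classes"

end

(*
Ordering the children of every vertex turns a tree T into a plane tree.  There are
prod_v |out(v)|! such orderings, Aut(T) acts on them freely, and its orbits are the plane trees of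
shape T.  Hence 1/|Aut(T)| is the sum of prod_v 1/|out(v)|! over the plane trees of shape T, and
p_A becomes a sum over plane trees, which are just sequences of plane trees: sequences of length k
contribute (g_1 p_A[1])^k / k!.
*)
theory Submission
  imports Defs "HOL-Combinatorics.Multiset_Permutations"
begin

section \<open>Generating series of locally finite weighted families\<close>

text \<open>Unary vertices have exponent 0, so they are invisible in a monomial, and the degree of a
  monomial bounds neither the height nor the number of vertices of a tree. The absence of trivial
  tails restores finiteness: below any non-leaf vertex some vertex branches, and its level is an
  index occurring in the monomial. Infinite sums are handled by writing each series as a weighted,
  locally finite family; identities of series then become weight-preserving bijections of index
  sets. The boundary terms of the formula arise as follows. A root with k children carries only k -
  1 copies of g_1, whence the division by g_1. The empty sequence of subtrees is the -1. The
  constant 1 of the series is the single leaf, which takes the place of the one sequence (a lone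
  leaf) whose tree is a trivial tail.\<close>

definition locally_finite :: "('i \<Rightarrow> 'v multiset) \<Rightarrow> 'i set \<Rightarrow> bool" where
  "locally_finite d I \<longleftrightarrow> (\<forall>m. finite {i \<in> I. d i = m})"

definition gen_series :: "('i \<Rightarrow> 'v multiset) \<Rightarrow> ('i \<Rightarrow> 'a::comm_ring_1) \<Rightarrow> 'i set \<Rightarrow> ('v, 'a) mfps" where
  "gen_series d c I = Abs_mfps (\<lambda>m. \<Sum>i \<in> {i \<in> I. d i = m}. c i)"

lemma mcoeff_gen_series: "mcoeff (gen_series d c I) m = (\<Sum>i \<in> {i \<in> I. d i = m}. c i)"
  by (simp add: gen_series_def)

lemma mcoeff_mult: "mcoeff (f * g) m = (\<Sum>(a, b) \<in> {(a, b). a + b = m}. mcoeff f a * mcoeff g b)"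
  by (simp add: times_mfps_def)

lemma gen_series_mult:
  assumes "locally_finite d A" "locally_finite e B"
  shows "gen_series d c A * gen_series e c' B =
    gen_series (\<lambda>(a, b). d a + e b) (\<lambda>(a, b). c a * c' b) (A \<times> B)"
proof (rule mfps_eqI)
  fix m
  let ?A = "\<lambda>p. {a \<in> A. d a = p}" and ?B = "\<lambda>q. {b \<in> B. e b = q}"
  have fin: "finite (?A p)" "finite (?B q)" for p q
    using assms by (auto simp: locally_finite_def)
  have "mcoeff (gen_series d c A * gen_series e c' B) m =
      (\<Sum>x \<in> {(p, q). p + q = m}. \<Sum>y \<in> ?A (fst x) \<times> ?B (snd x). c (fst y) * c' (snd y))"
    by (simp add: mcoeff_mult mcoeff_gen_series sum_product sum.cartesian_product case_prod_unfold)
  also have "\<dots> = (\<Sum>(x, y) \<in> (SIGMA x:{(p, q). p + q = m}. ?A (fst x) \<times> ?B (snd x)).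
      c (fst y) * c' (snd y))"
    by (rule sum.Sigma) (auto simp: finite_factorizations fin)
  \<comment> \<open>A pair \<open>(a, b)\<close> lies over exactly one factorization of
    \<open>m\<close>, namely \<open>(d a, e b)\<close>, so the outer index is redundant.\<close>
  also have "\<dots> = (\<Sum>(a, b) \<in> {(a, b) \<in> A \<times> B. d a + e b = m}. c a * c' b)"
    by (rule sum.reindex_bij_witness[where i = "\<lambda>(a, b). ((d a, e b), (a, b))" and j = snd]) auto
  finally show "mcoeff (gen_series d c A * gen_series e c' B) m =
      mcoeff (gen_series (\<lambda>(a, b). d a + e b) (\<lambda>(a, b). c a * c' b) (A \<times> B)) m"
    by (simp add: mcoeff_gen_series case_prod_unfold mem_Times_iff)
qed

lemma gen_series_reindex:
  assumes "bij_betw h A B" "\<And>a. a \<in> A \<Longrightarrow> d a = e (h a)" "\<And>a. a \<in> A \<Longrightarrow> c a = c' (h a)"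
  shows "gen_series d c A = gen_series e c' B"
proof (rule mfps_eqI)
  fix m
  have "bij_betw h {a \<in> A. d a = m} {b \<in> B. e b = m}"
    using assms by (auto simp: bij_betw_def inj_on_def)
  then have "(\<Sum>a \<in> {a \<in> A. d a = m}. c' (h a)) = (\<Sum>b \<in> {b \<in> B. e b = m}. c' b)"
    by (rule sum.reindex_bij_betw)
  then show "mcoeff (gen_series d c A) m = mcoeff (gen_series e c' B) m"
    using assms(3) by (simp add: mcoeff_gen_series cong: sum.cong_simp)
qed

text \<open>Each entry has a monomial dividing the total, and a monomial has finitely many divisors.
  The length is fixed because entries with empty monomial, such as the single leaf, could otherwise
  be repeated without bound.\<close>

lemma locally_finite_lists_length:
  assumes "locally_finite d A"
  shows "locally_finite (\<lambda>xs. sum_list (map d xs)) {xs \<in> lists A. length xs = k}"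
  unfolding locally_finite_def
proof
  fix m
  have "{xs \<in> {xs \<in> lists A. length xs = k}. sum_list (map d xs) = m} \<subseteq>
    {xs. set xs \<subseteq> (\<Union>p \<in> {p. p \<subseteq># m}. {a \<in> A. d a = p}) \<and> length xs = k}"
    by (auto simp: in_lists_conv_set dest!: split_list)
  moreover have "finite (\<Union>p \<in> {p. p \<subseteq># m}. {a \<in> A. d a = p})"
    using assms by (auto simp: locally_finite_def finite_submultisets)
  ultimately show "finite {xs \<in> {xs \<in> lists A. length xs = k}. sum_list (map d xs) = m}"
    using finite_lists_length_eq finite_subset by blast
qed

lemma gen_series_power:
  assumes "locally_finite d A"
  shows "gen_series d c A ^ k =
    gen_series (\<lambda>xs. sum_list (map d xs)) (\<lambda>xs. prod_list (map c xs)) {xs \<in> lists A. length xs = k}"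
proof (induction k)
  case 0
  have "{xs. (xs \<in> lists A \<and> xs = []) \<and> sum_list (map d xs) = m} = (if m = {#} then {[]} else {})" for m
    by auto
  then show ?case
    by (auto intro!: mfps_eqI simp: one_mfps_def mcoeff_gen_series)
next
  case (Suc k)
  have bij: "bij_betw (\<lambda>(x, xs). x # xs) (A \<times> {xs \<in> lists A. length xs = k}) {xs \<in> lists A. length xs = Suc k}"
    by (rule bij_betw_byWitness[where f' = "\<lambda>xs. (hd xs, tl xs)"]) (auto simp: length_Suc_conv)
  show ?case
    unfolding power_Suc Suc gen_series_mult[OF assms locally_finite_lists_length[OF assms]]
    by (rule gen_series_reindex[OF bij]) auto
qed

section \<open>Monomials and division by a variable\<close>

definition mfps_monom :: "'v multiset \<Rightarrow> ('v, 'a::comm_ring_1) mfps" where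
  "mfps_monom M = Abs_mfps (\<lambda>m. if m = M then 1 else 0)"

lemma mfps_var_eq_monom: "mfps_var i = mfps_monom {#i#}"
  by (simp add: mfps_var_def mfps_monom_def)

lemma mfps_monom_empty [simp]: "mfps_monom {#} = 1"
  by (simp add: mfps_monom_def one_mfps_def)

lemma mcoeff_monom_mult:
  "mcoeff (mfps_monom M * f) m = (if M \<subseteq># m then mcoeff f (m - M) else 0)"
proof -
  have "mcoeff (mfps_monom M * f) m =
      (\<Sum>(a, b) \<in> {(a, b). a + b = m}. if a = M then mcoeff f b else 0)"
    by (auto simp: mcoeff_mult mfps_monom_def intro!: sum.cong)
  also have "\<dots> = (\<Sum>(a, b) \<in> (if M \<subseteq># m then {(M, m - M)} else {}). if a = M then mcoeff f b else 0)"
    by (rule sum.mono_neutral_right) (auto simp: finite_factorizations split: if_splits)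
  finally show ?thesis by simp
qed

lemma mfps_monom_mult: "mfps_monom M * mfps_monom N = mfps_monom (M + N)"
proof (rule mfps_eqI)
  fix m
  show "mcoeff (mfps_monom M * mfps_monom N) m = mcoeff (mfps_monom (M + N)) m"
    by (auto simp: mcoeff_monom_mult) (auto simp: mfps_monom_def)
qed

lemma mfps_var_power: "mfps_var i ^ k = mfps_monom (replicate_mset k i)"
  by (induction k) (simp_all add: mfps_var_eq_monom mfps_monom_mult)

lemma prod_mfps_monom: "(\<Prod>x \<in> A. mfps_monom (f x)) = mfps_monom (\<Sum>x \<in> A. f x)"
  by (induction A rule: infinite_finite_induct) (simp_all add: mfps_monom_mult)

lemma mfps_monom_mult_gen_series:
  "mfps_monom M * gen_series d c A = gen_series (\<lambda>a. M + d a) c A"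
proof (rule mfps_eqI)
  fix m
  have "{a \<in> A. M + d a = m} = (if M \<subseteq># m then {a \<in> A. d a = m - M} else {})"
    by auto
  then show "mcoeff (mfps_monom M * gen_series d c A) m = mcoeff (gen_series (\<lambda>a. M + d a) c A) m"
    by (simp add: mcoeff_monom_mult mcoeff_gen_series)
qed

text \<open>Multiplying by a variable only shifts coefficients. This gives the uniqueness that the
  definite description in \<open>mfps_quotient\<close> asks for.\<close>

lemma mfps_var_mult_left_cancel:
  assumes "mfps_var i * f = mfps_var i * g"
  shows "f = g"
proof (rule mfps_eqI)
  fix m
  have "mcoeff (mfps_var i * f) (add_mset i m) = mcoeff (mfps_var i * g) (add_mset i m)"
    by (simp add: assms)
  then show "mcoeff f m = mcoeff g m"
    by (simp add: mfps_var_eq_monom mcoeff_monom_mult)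
qed

lemma mfps_quotient_var: "mfps_quotient (mfps_var i * q) (mfps_var i) = q"
  unfolding mfps_quotient_def by (rule the_equality) (auto dest: mfps_var_mult_left_cancel)

lemma mcoeff_const_mult:
  fixes f :: "('v, 'a::comm_ring_1) mfps"
  shows "mcoeff (mfps_const c * f) m = c * mcoeff f m"
proof -
  have "mcoeff (mfps_const c * f) m =
      (\<Sum>(a, b) \<in> {(a, b). a + b = m}. if a = {#} then c * mcoeff f b else 0)"
    by (auto simp: mcoeff_mult mfps_const_def intro!: sum.cong)
  also have "\<dots> = (\<Sum>(a, b) \<in> {({#} :: 'v multiset, m)}. if a = {#} then c * mcoeff f b else 0)"
    by (intro sum.mono_neutral_right) (auto simp: finite_factorizations split: if_splits)
  finally show ?thesis by simp
qed

lemma mfps_const_mult_gen_series: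
  "mfps_const b * gen_series d c A = gen_series d (\<lambda>a. b * c a) A"
  by (rule mfps_eqI) (simp add: mcoeff_const_mult mcoeff_gen_series sum_distrib_left)

section \<open>Substitution and exponential\<close>

lemma mfps_rename_gen_series:
  assumes "inj \<sigma>" "locally_finite d A"
  shows "mfps_rename \<sigma> (gen_series d c A) = gen_series (\<lambda>a. image_mset \<sigma> (d a)) c A"
proof (rule mfps_eqI)
  fix m
  let ?S = "{m'. image_mset \<sigma> m' = m}"
  \<comment> \<open>Injectivity on variables lifts to monomials, so \<open>m\<close> has at most one
    preimage.\<close>
  have inj: "inj (image_mset \<sigma>)"
    using assms(1) by (rule multiset.inj_map)
  then have fin: "finite ?S"
    using finite_vimageI[of "{m}"] by (simp add: vimage_def)
  have "mcoeff (mfps_rename \<sigma> (gen_series d c A)) m = (\<Sum>m' \<in> ?S. \<Sum>a \<in> {a \<in> A. d a = m'}. c a)"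
    by (simp add: mfps_rename_def mcoeff_gen_series)
  also have "\<dots> = (\<Sum>a \<in> (\<Union>m' \<in> ?S. {a \<in> A. d a = m'}). c a)"
    using assms(2) fin by (intro sum.UNION_disjoint[symmetric]) (auto simp: locally_finite_def)
  also have "(\<Union>m' \<in> ?S. {a \<in> A. d a = m'}) = {a \<in> A. image_mset \<sigma> (d a) = m}"
    by auto
  finally show "mcoeff (mfps_rename \<sigma> (gen_series d c A)) m =
      mcoeff (gen_series (\<lambda>a. image_mset \<sigma> (d a)) c A) m"
    by (simp add: mcoeff_gen_series)
qed

text \<open>The variable in front marks the length of a list: lists of length \<open>k\<close> carry
  \<open>k\<close> copies of \<open>i\<close>, so only \<open>k \<le> size m\<close> can contribute
  to the coefficient of \<open>m\<close>. This makes the exponential meaningful even when the family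
  contains a member with empty monomial.\<close>

lemma mfps_exp_var_mult_gen_series:
  fixes c :: "'i \<Rightarrow> 'a::field_char_0"
  assumes "locally_finite d A"
  shows "mfps_exp (mfps_var i * gen_series d c A) =
    gen_series (\<lambda>xs. replicate_mset (length xs) i + sum_list (map d xs))
      (\<lambda>xs. 1 / fact (length xs) * prod_list (map c xs)) (lists A)"
    (is "_ = gen_series ?d ?c _")
proof (rule mfps_eqI)
  fix m
  let ?L = "\<lambda>k. {xs \<in> lists A. length xs = k}"
  let ?f = "\<lambda>k. mfps_const (1 / fact k) * (mfps_var i * gen_series d c A) ^ k"
  have f: "?f k = gen_series ?d ?c (?L k)" for k
    by (simp add: power_mult_distrib mfps_var_power gen_series_power[OF assms]
        mfps_monom_mult_gen_series mfps_const_mult_gen_series)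
       (auto intro!: mfps_eqI sum.cong simp: mcoeff_gen_series)
  have le: "k \<le> size m" if "mcoeff (?f k) m \<noteq> 0" for k
  proof -
    have "{xs \<in> ?L k. ?d xs = m} \<noteq> {}"
      using that unfolding f mcoeff_gen_series by (metis (no_types, lifting) sum.empty)
    then show ?thesis by auto
  qed
  have fin: "finite {xs \<in> ?L k. ?d xs = m}" for k
  proof (rule finite_subset)
    show "{xs \<in> ?L k. ?d xs = m} \<subseteq> {xs \<in> ?L k. sum_list (map d xs) = m - replicate_mset k i}"
      by auto
    show "finite {xs \<in> ?L k. sum_list (map d xs) = m - replicate_mset k i}"
      using locally_finite_lists_length[OF assms] by (simp add: locally_finite_def)
  qed
  have "mcoeff (mfps_exp (mfps_var i * gen_series d c A)) m = (\<Sum>k \<in> {k. mcoeff (?f k) m \<noteq> 0}. mcoeff (?f k) m)"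
    by (simp add: mfps_exp_def mfps_sum_def)
  also have "\<dots> = (\<Sum>k \<le> size m. mcoeff (?f k) m)"
    using le by (intro sum.mono_neutral_left) auto
  also have "\<dots> = (\<Sum>k \<le> size m. \<Sum>xs \<in> {xs \<in> ?L k. ?d xs = m}. ?c xs)"
    by (simp only: f mcoeff_gen_series)
  also have "\<dots> = (\<Sum>xs \<in> (\<Union>k \<le> size m. {xs \<in> ?L k. ?d xs = m}). ?c xs)"
    using fin by (intro sum.UNION_disjoint[symmetric]) auto
  also have "(\<Union>k \<le> size m. {xs \<in> ?L k. ?d xs = m}) = {xs \<in> lists A. ?d xs = m}"
    by auto
  finally show "mcoeff (mfps_exp (mfps_var i * gen_series d c A)) m = mcoeff (gen_series ?d ?c (lists A)) m"
    by (simp only: mcoeff_gen_series)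
qed

section \<open>Plane trees\<close>

text \<open>Labels let one type serve two purposes: labelled by the vertices of a tree it records an
  ordering of all sets of children, and with \<open>unit\<close> labels it is a bare plane
  tree.\<close>

datatype 'n ptree = Node (root_label: 'n) (subtrees: "'n ptree list")

abbreviation shape :: "'n ptree \<Rightarrow> unit ptree" where
  "shape \<equiv> map_ptree (\<lambda>_. ())"

primrec preorder :: "'n ptree \<Rightarrow> 'n list" where
  "preorder (Node v Ls) = v # concat (map preorder Ls)"

primrec num_leaves :: "'n ptree \<Rightarrow> nat" where
  "num_leaves (Node v Ls) = (if Ls = [] then 1 else sum_list (map num_leaves Ls))"

primrec weight :: "'n ptree \<Rightarrow> rat" where
  "weight (Node v Ls) = 1 / fact (length Ls) * prod_list (map weight Ls)"

text \<open>The second argument is the level assigned to the root. Primitive recursion through a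
  list passes by \<open>map monomial Ls\<close>, hence the list of functions applied to
  \<open>Suc l\<close>; \<open>monomial_Node\<close> is the readable form. Truncated subtraction
  makes a leaf contribute nothing.\<close>

primrec monomial :: "'n ptree \<Rightarrow> nat \<Rightarrow> nat multiset" where
  "monomial (Node v Ls) = (\<lambda>l. replicate_mset (length Ls - 1) l +
     sum_list (map (\<lambda>f. f (Suc l)) (map monomial Ls)))"

fun no_tails :: "'n ptree \<Rightarrow> bool" where
  "no_tails (Node v Ls) \<longleftrightarrow> \<not> (length Ls = 1 \<and> num_leaves (Node v Ls) = 1) \<and> (\<forall>L \<in> set Ls. no_tails L)"

lemma set_preorder [simp]: "set (preorder L) = set_ptree L"
  by (induction L) auto

lemma preorder_map: "preorder (map_ptree f L) = map f (preorder L)"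
  by (induction L) (simp add: map_concat o_def cong: map_cong)

lemma num_leaves_map [simp]: "num_leaves (map_ptree f L) = num_leaves L"
  by (induction L) (simp add: o_def cong: map_cong)

lemma weight_map [simp]: "weight (map_ptree f L) = weight L"
  by (induction L) (simp add: o_def cong: map_cong)

lemma monomial_map [simp]: "monomial (map_ptree f L) l = monomial L l"
  by (induction L arbitrary: l) (simp add: o_def cong: map_cong)

lemma no_tails_map [simp]: "no_tails (map_ptree f L) = no_tails L"
proof (induction L)
  case (Node v Ls)
  then have "(\<forall>L \<in> set Ls. no_tails (map_ptree f L)) = (\<forall>L \<in> set Ls. no_tails L)"
    by blast
  then show ?case
    by (simp add: o_def)
qed

lemma root_label_map [simp]: "root_label (map_ptree f L) = f (root_label L)"
  by (cases L) simp

lemma root_label_in_set [simp]: "root_label L \<in> set_ptree L"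
  by (cases L) simp

lemma num_leaves_pos: "num_leaves L > 0"
proof (induction L)
  case (Node v Ls)
  then show ?case
    by (cases Ls) auto
qed

lemma weight_pos: "weight L > 0"
proof (induction L)
  case (Node v Ls)
  then have "prod_list (map weight Ls) > 0"
    by (induction Ls) auto
  then show ?case by simp
qed

lemma length_le_num_leaves: "length Ls \<le> sum_list (map num_leaves Ls)"
proof (induction Ls)
  case (Cons L Ls)
  then show ?case using num_leaves_pos[of L] by simp
qed simp

text \<open>Every child has a leaf below it, so a non-leaf root with a single leaf has exactly one
  child and starts a trivial tail.\<close>

lemma no_tails_num_leaves_eq_1:
  assumes "no_tails L" "num_leaves L = 1"
  shows "subtrees L = []"
proof (cases L)
  case (Node v Ls)
  show ?thesis
  proof (rule ccontr)
    assume "subtrees L \<noteq> []"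
    then have "Ls \<noteq> []" by (simp add: Node)
    moreover have "length Ls \<le> 1"
      using assms(2) \<open>Ls \<noteq> []\<close> length_le_num_leaves[of Ls] by (simp add: Node)
    ultimately have "length Ls = 1"
      by (cases Ls) auto
    then show False using assms by (simp add: Node)
  qed
qed

text \<open>When the children are free of tails, a tail at the root forces its only child to have
  one leaf, hence to be a leaf. Freeness from tails thus forbids one single list of children, which
  makes these trees almost the same as lists of such trees.\<close>

lemma no_tails_Node:
  fixes Ps :: "unit ptree list"
  shows "no_tails (Node u Ps) \<longleftrightarrow> Ps \<noteq> [Node () []] \<and> (\<forall>P \<in> set Ps. no_tails P)"
proof -
  have "length Ps = 1 \<and> num_leaves (Node u Ps) = 1 \<longleftrightarrow> Ps = [Node () []]"
    if "\<forall>P \<in> set Ps. no_tails P"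
  proof
    assume *: "length Ps = 1 \<and> num_leaves (Node u Ps) = 1"
    then obtain P where "Ps = [P]" by (auto simp: length_Suc_conv)
    with * that no_tails_num_leaves_eq_1[of P] show "Ps = [Node () []]"
      by (cases P) auto
  qed simp
  then show ?thesis by auto
qed

lemma num_leaves_ge_2_iff:
  assumes "no_tails L"
  shows "num_leaves L \<ge> 2 \<longleftrightarrow> subtrees L \<noteq> []"
proof -
  have "subtrees L = [] \<Longrightarrow> num_leaves L = 1"
    by (cases L) simp
  then show ?thesis
    using no_tails_num_leaves_eq_1[OF assms] num_leaves_pos[of L] by linarith
qed

text \<open>The shape fixes the length of the block that each subtree occupies in the preorder, so
  the list of labels can be cut in only one way.\<close>

lemma ptree_eq_if_preorder_eq:
  assumes "shape L = shape L'" "preorder L = preorder L'"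
  shows "L = L'"
  using assms
proof (induction L arbitrary: L')
  case (Node v Ls)
  obtain v' Ls' where L': "L' = Node v' Ls'" by (cases L')
  have len: "length (preorder M) = length (preorder M')" if "shape M = shape M'"
    for M :: "'a ptree" and M' :: "'a ptree"
    using that by (metis length_map preorder_map)
  have shapes: "map shape Ls = map shape Ls'" and conc: "concat (map preorder Ls) = concat (map preorder Ls')"
    using Node.prems by (simp_all add: L')
  have "Ls = Ls'"
    using Node.IH shapes conc
  proof (induction Ls arbitrary: Ls')
    case (Cons M Ms)
    then obtain M' Ms' where Ls': "Ls' = M' # Ms'" by auto
    with Cons.prems len[of M M'] have "preorder M = preorder M'" "concat (map preorder Ms) = concat (map preorder Ms')"
      by auto
    with Cons.prems Cons.IH[of Ms'] show ?case
      by (auto simp: Ls')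
  qed simp
  then show ?case using Node.prems(2) by (simp add: L')
qed

lemma ex_map_eq:
  assumes "distinct xs" "length xs = length ys"
  shows "\<exists>f. map f xs = ys"
proof
  show "map (\<lambda>x. the (map_of (zip xs ys) x)) xs = ys"
    using assms by (auto intro!: nth_equalityI simp: map_of_zip_nth)
qed

text \<open>The relabelling sends the i-th label in preorder to the i-th label in preorder; it is
  well defined and bijective because the labels are distinct on both sides.\<close>

lemma ex_map_ptree_eq:
  assumes "distinct (preorder L)" "distinct (preorder L')" "shape L = shape L'"
  shows "\<exists>f. map_ptree f L = L' \<and> bij_betw f (set_ptree L) (set_ptree L')"
proof -
  have "length (preorder L) = length (preorder L')"
    using assms(3) by (metis length_map preorder_map)
  then obtain f where f: "map f (preorder L) = preorder L'"
    using ex_map_eq[OF assms(1)] by blast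
  have "map_ptree f L = L'"
    by (rule ptree_eq_if_preorder_eq) (simp_all add: preorder_map f ptree.map_comp o_def assms(3))
  moreover have "bij_betw f (set_ptree L) (set_ptree L')"
    using assms(2) f
    by (metis bij_betw_def distinct_map list.set_map set_preorder)
  ultimately show ?thesis by blast
qed

lemma ex_ptree_with_labels:
  assumes "length xs = length (preorder P)"
  shows "\<exists>L. shape L = shape P \<and> preorder L = xs"
  using assms
proof (induction P arbitrary: xs)
  case (Node v Ps)
  then obtain x ys where xs: "xs = x # ys" and ys: "length ys = length (concat (map preorder Ps))"
    by (cases xs) auto
  have "\<exists>Ls. map shape Ls = map shape Ps \<and> concat (map preorder Ls) = ys"
    using Node.IH ys
  proof (induction Ps arbitrary: ys)
    case (Cons P Ps)
    obtain L where L: "shape L = shape P" "preorder L = take (length (preorder P)) ys"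
      using Cons.prems(1)[of P "take (length (preorder P)) ys"] Cons.prems(2) by auto
    obtain Ls where "map shape Ls = map shape Ps"
      "concat (map preorder Ls) = drop (length (preorder P)) ys"
      using Cons.IH[of "drop (length (preorder P)) ys"] Cons.prems by auto
    with L show ?case by (intro exI[of _ "L # Ls"]) simp
  qed simp
  then obtain Ls where "map shape Ls = map shape Ps" "concat (map preorder Ls) = ys"
    by blast
  then show ?case
    by (intro exI[of _ "Node x Ls"]) (simp add: xs)
qed


section \<open>Plane embeddings of rooted trees\<close>

text \<open>Choosing an order on the children of every vertex amounts to choosing such a labelled
  plane tree, so orderings can be counted as elements of a set of \<open>ptree\<close>s.\<close>

fun embeds :: "('n \<times> 'n) set \<Rightarrow> 'n ptree \<Rightarrow> bool" where
  "embeds E (Node v Ls) \<longleftrightarrow> distinct (map root_label Ls) \<and> root_label ` set Ls = E `` {v} \<and>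
     (\<forall>L \<in> set Ls. embeds E L)"

definition embeddings_at :: "('n \<times> 'n) set \<Rightarrow> 'n \<Rightarrow> 'n ptree set" where
  "embeddings_at E v = {L. embeds E L \<and> root_label L = v}"

abbreviation embeddings :: "'n tree \<Rightarrow> 'n ptree set" where
  "embeddings T \<equiv> embeddings_at (edges T) (tree_root T)"

lemma listset_eq: "listset As = {xs. list_all2 (\<in>) xs As}"
  by (induction As) (auto simp: set_Cons_def list_all2_Cons2)

lemma card_listset: "card (listset As) = prod_list (map card As)"
proof (induction As)
  case (Cons A As)
  have "listset (A # As) = (\<lambda>(x, xs). x # xs) ` (A \<times> listset As)"
    by (auto simp: set_Cons_def)
  moreover have "inj_on (\<lambda>(x, xs). x # xs) (A \<times> listset As)"
    by (auto simp: inj_on_def)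
  ultimately show ?case
    by (simp add: card_image card_cartesian_product Cons)
qed simp

lemma finite_listset: "(\<And>A. A \<in> set As \<Longrightarrow> finite A) \<Longrightarrow> finite (listset As)"
proof (induction As)
  case (Cons A As)
  have "listset (A # As) = (\<lambda>(x, xs). x # xs) ` (A \<times> listset As)"
    by (auto simp: set_Cons_def)
  with Cons show ?case by simp
qed simp

text \<open>An embedding is an order \<open>ws\<close> of the children followed by independent
  embeddings below each child. The order can be recovered as the list of root labels of the
  subtrees, so the union is disjoint.\<close>

lemma embeddings_at_eq:
  fixes E :: "('n \<times> 'n) set"
  shows "embeddings_at E v =
    (\<Union>ws \<in> permutations_of_set (E `` {v}). Node v ` listset (map (embeddings_at E) ws))"
proof (intro set_eqI)
  fix L :: "'n ptree"
  obtain u Ls where L: "L = Node u Ls" by (cases L)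
  have *: "list_all2 (\<in>) Ls (map (embeddings_at E) ws) \<longleftrightarrow> ws = map root_label Ls \<and> (\<forall>L \<in> set Ls. embeds E L)"
    for ws
    by (auto simp: list_all2_conv_all_nth embeddings_at_def all_set_conv_all_nth list_eq_iff_nth_eq)
  show "L \<in> embeddings_at E v \<longleftrightarrow>
    L \<in> (\<Union>ws \<in> permutations_of_set (E `` {v}). Node v ` listset (map (embeddings_at E) ws))"
    by (auto simp: L listset_eq * embeddings_at_def permutations_of_set_def image_iff)
qed

text \<open>The count is the product of the factorials of the out-degrees, which is the reciprocal
  of \<open>weight\<close>. Induction runs over one given embedding, whose finiteness also bounds
  the part of \<open>E\<close> that matters.\<close>

lemma card_embeddings_at:
  assumes "embeds E L"
  shows "finite (embeddings_at E (root_label L)) \<and>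
    of_nat (card (embeddings_at E (root_label L))) * weight L = 1"
  using assms
proof (induction L)
  case (Node v Ls)
  let ?P = "permutations_of_set (E `` {v})"
  let ?N = "\<lambda>ws. Node v ` listset (map (embeddings_at E) ws)"
  \<comment> \<open>The number of ways to embed everything below the children; it is the same for
    each order of the children.\<close>
  define p where "p = (\<Prod>w \<in> E `` {v}. card (embeddings_at E w))"
  have IH: "finite (embeddings_at E (root_label L))"
    "of_nat (card (embeddings_at E (root_label L))) * weight L = 1" if "L \<in> set Ls" for L
    using Node that by auto
  have dist: "distinct (map root_label Ls)" and children: "root_label ` set Ls = E `` {v}"
    using Node.prems by auto
  have fin: "finite (?N ws)" if "ws \<in> ?P" for ws
  proof -
    have "set ws = root_label ` set Ls"
      using that by (simp add: children permutations_of_set_def)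
    then show ?thesis
      using IH(1) by (intro finite_imageI finite_listset) auto
  qed
  have disj: "?N ws \<inter> ?N ws' = {}" if "ws \<noteq> ws'" for ws ws'
  proof (rule ccontr)
    assume "?N ws \<inter> ?N ws' \<noteq> {}"
    then obtain Ms where "list_all2 (\<in>) Ms (map (embeddings_at E) ws)"
      "list_all2 (\<in>) Ms (map (embeddings_at E) ws')"
      by (auto simp: listset_eq)
    then have "ws = map root_label Ms" "ws' = map root_label Ms"
      by (auto simp: list_all2_conv_all_nth embeddings_at_def list_eq_iff_nth_eq)
    with that show False by simp
  qed
  have card_N: "card (?N ws) = p" if "ws \<in> ?P" for ws
  proof -
    have "card (?N ws) = prod_list (map (\<lambda>w. card (embeddings_at E w)) ws)"
      by (subst card_image) (auto simp: inj_on_def card_listset o_def)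
    also have "\<dots> = p"
    proof -
      have "E `` {v} = set ws" "distinct ws"
        using that by (auto simp: permutations_of_set_def)
      then show ?thesis by (simp add: p_def prod.distinct_set_conv_list)
    qed
    finally show ?thesis .
  qed
  have finite_children: "finite (E `` {v})"
    using children by (metis List.finite_set finite_imageI)
  have card_children: "card (E `` {v}) = length Ls"
    using distinct_card[OF dist] by (simp add: children)
  have "card (embeddings_at E v) = (\<Sum>ws \<in> ?P. card (?N ws))"
    unfolding embeddings_at_eq[of E v] using fin disj by (intro card_UN_disjoint) auto
  also have "\<dots> = fact (length Ls) * p"
    using finite_children by (simp add: card_N card_children)
  finally have card: "card (embeddings_at E v) = fact (length Ls) * p" .
  have p: "of_nat p * prod_list (map weight Ls) = 1"
  proof -
    have "p = prod_list (map (\<lambda>L. card (embeddings_at E (root_label L))) Ls)"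
      using prod.distinct_set_conv_list[OF dist, of "\<lambda>w. card (embeddings_at E w)"]
      by (simp add: p_def children o_def)
    \<comment> \<open>Each factor of the count cancels against the weight of the same subtree.
      Passing to arbitrary lists \<open>Ms\<close> from \<open>Ls\<close> allows induction while the
      facts about \<open>Ls\<close> stay fixed.\<close>
    moreover have "of_nat (prod_list (map (\<lambda>L. card (embeddings_at E (root_label L))) Ms)) *
        prod_list (map weight Ms) = 1" if "set Ms \<subseteq> set Ls" for Ms
      using that
    proof (induction Ms)
      case (Cons M Ms)
      then show ?case using IH(2)[of M] by (simp add: algebra_simps)
    qed simp
    ultimately show ?thesis by simp
  qed
  have "of_nat (card (embeddings_at E v)) * weight (Node v Ls) = of_nat p * prod_list (map weight Ls)"
    by (simp only: card weight.simps of_nat_mult of_nat_fact) simp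
  with p have "of_nat (card (embeddings_at E v)) * weight (Node v Ls) = 1"
    by (rule trans[rotated])
  moreover have "finite (embeddings_at E v)"
    unfolding embeddings_at_eq[of E v] using fin by auto
  ultimately show ?case by (simp only: ptree.sel)
qed

lemma embeds_set_ptree:
  assumes "embeds E L"
  shows "set_ptree L = E\<^sup>* `` {root_label L}"
  using assms
proof (induction L)
  case (Node v Ls)
  have "set_ptree (Node v Ls) = insert v (\<Union>L \<in> set Ls. E\<^sup>* `` {root_label L})"
    using Node by auto
  also have "\<dots> = insert v (E\<^sup>* `` (root_label ` set Ls))"
    by auto
  also have "\<dots> = insert v (E\<^sup>* `` (E `` {v}))"
    using Node.prems by simp
  also have "\<dots> = E\<^sup>* `` {v}"
    by (auto intro: converse_rtrancl_into_rtrancl elim: converse_rtranclE)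
  finally show ?case by simp
qed

lemma embeds_map:
  assumes "embeds E L" "inj_on f A" "set_ptree L \<subseteq> A"
    "\<And>v. v \<in> A \<Longrightarrow> E' `` {f v} = f ` (E `` {v})"
  shows "embeds E' (map_ptree f L)"
  using assms(1,3)
proof (induction L)
  case (Node v Ls)
  have sub: "root_label ` set Ls \<subseteq> A"
  proof
    fix w assume "w \<in> root_label ` set Ls"
    then obtain L where "L \<in> set Ls" "w = root_label L" by blast
    then have "w \<in> set_ptree (Node v Ls)"
      using root_label_in_set[of L] unfolding ptree.set by blast
    then show "w \<in> A" using Node.prems(2) by blast
  qed
  have "distinct (map f (map root_label Ls))"
    using Node.prems(1) sub by (subst distinct_map) (auto intro: inj_on_subset[OF assms(2)])
  moreover have "f ` root_label ` set Ls = E' `` {f v}"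
    using Node.prems assms(4)[of v] by simp
  moreover have "embeds E' (map_ptree f L)" if "L \<in> set Ls" for L
    using Node that by auto
  ultimately show ?case
    by (simp add: o_def image_image)
qed

lemma embeds_cong:
  assumes "\<And>v. v \<in> set_ptree L \<Longrightarrow> E `` {v} = E' `` {v}"
  shows "embeds E L \<longleftrightarrow> embeds E' L"
  using assms
proof (induction L)
  case (Node v Ls)
  have "E `` {v} = E' `` {v}"
    using Node.prems by simp
  moreover have "embeds E L \<longleftrightarrow> embeds E' L" if "L \<in> set Ls" for L
    using that Node.prems by (intro Node.IH) auto
  ultimately show ?case by simp
qed

section \<open>Paths and levels in a rooted tree\<close>

lemma parent_unique:
  assumes "rooted_tree T" "(u, w) \<in> edges T" "(u', w) \<in> edges T"
  shows "u = u'"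
proof -
  have "w \<in> vertices T - {tree_root T}"
    using assms by (auto simp: rooted_tree_def)
  then have "\<exists>!u. (u, w) \<in> edges T"
    using assms(1) unfolding rooted_tree_def by blast
  then show ?thesis using assms by blast
qed

lemma ancestor_unique:
  assumes "rooted_tree T" "(u, w) \<in> edges T ^^ k" "(u', w) \<in> edges T ^^ k"
  shows "u = u'"
  using assms(2,3) by (induction k arbitrary: w) (auto dest: parent_unique[OF assms(1)])

text \<open>Walking back from \<open>v\<close> is deterministic and must stop at the root, which has
  no parent. So the minimum in \<open>level\<close> is attained by the only possible path
  length.\<close>

lemma path_length_unique:
  assumes "rooted_tree T" "(tree_root T, v) \<in> edges T ^^ j" "(tree_root T, v) \<in> edges T ^^ k"
  shows "j = k"
  using assms(2,3)
proof (induction j arbitrary: k v)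
  case 0
  then show ?case using assms(1) by (cases k) (auto simp: rooted_tree_def)
next
  case (Suc j)
  then obtain u where u: "(tree_root T, u) \<in> edges T ^^ j" "(u, v) \<in> edges T" by auto
  then have "k \<noteq> 0"
    using assms(1) Suc.prems(2) by (intro notI) (auto simp: rooted_tree_def)
  then obtain k' where k: "k = Suc k'" by (cases k) auto
  with Suc.prems(2) u(2) parent_unique[OF assms(1)] have "(tree_root T, u) \<in> edges T ^^ k'"
    by auto
  with Suc.IH[OF u(1)] k show ?case by simp
qed

lemma level_eq:
  assumes "rooted_tree T" "(tree_root T, v) \<in> edges T ^^ k"
  shows "level T v = Suc k"
  unfolding level_def using assms by (metis LeastI path_length_unique plus_1_eq_Suc)

lemma level_root: "rooted_tree T \<Longrightarrow> level T (tree_root T) = 1"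
  using level_eq[of T "tree_root T" 0] by simp

lemma level_path:
  assumes "rooted_tree T" "v \<in> vertices T" "(v, w) \<in> edges T ^^ k"
  shows "level T w = level T v + k"
proof -
  have "(tree_root T, v) \<in> (edges T)\<^sup>*"
    using assms by (auto simp: rooted_tree_def)
  then obtain j where j: "(tree_root T, v) \<in> edges T ^^ j"
    by (auto simp: rtrancl_power)
  then have "(tree_root T, w) \<in> edges T ^^ (j + k)"
    using assms(3) by (auto simp: relpow_add)
  with j show ?thesis using level_eq[OF assms(1)] by auto
qed

lemma level_edge:
  assumes "rooted_tree T" "(v, w) \<in> edges T"
  shows "level T w = Suc (level T v)"
  using level_path[OF assms(1), of v w 1] assms by (auto simp: rooted_tree_def)

text \<open>Levels strictly increase along edges, so the finite edge relation is acyclic.\<close>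

lemma wf_converse_edges:
  assumes "rooted_tree T"
  shows "wf ((edges T)\<inverse>)"
proof (rule finite_acyclic_wf_converse)
  have "finite (vertices T \<times> vertices T)" "edges T \<subseteq> vertices T \<times> vertices T"
    using assms by (auto simp: rooted_tree_def)
  then show "finite (edges T)" by (rule rev_finite_subset)
  have "level T v < level T w" if "(v, w) \<in> (edges T)\<^sup>+" for v w
    using that by (induction rule: trancl.induct) (auto dest: level_edge[OF assms])
  then show "acyclic (edges T)" by (auto simp: acyclic_def)
qed

lemma vertices_eq_reachable:
  assumes "rooted_tree T"
  shows "vertices T = (edges T)\<^sup>* `` {tree_root T}"
proof -
  have "w \<in> vertices T" if "(tree_root T, w) \<in> (edges T)\<^sup>*" for w
    using that
  proof (induction rule: rtrancl_induct)
    case base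
    then show ?case using assms by (simp add: rooted_tree_def)
  next
    case (step v w)
    have "edges T \<subseteq> vertices T \<times> vertices T" using assms by (simp add: rooted_tree_def)
    with step.hyps(2) show ?case by blast
  qed
  moreover have "(tree_root T, w) \<in> (edges T)\<^sup>*" if "w \<in> vertices T" for w
    using that assms by (simp add: rooted_tree_def)
  ultimately show ?thesis by blast
qed

lemma reachable_in_vertices:
  assumes "rooted_tree T" "v \<in> vertices T"
  shows "(edges T)\<^sup>* `` {v} \<subseteq> vertices T"
  using assms(2) unfolding vertices_eq_reachable[OF assms(1)] by (blast intro: rtrancl_trans)

lemma finite_children:
  assumes "rooted_tree T"
  shows "finite (edges T `` {v})"
proof (rule finite_subset)
  show "edges T `` {v} \<subseteq> vertices T" "finite (vertices T)"
    using assms by (auto simp: rooted_tree_def)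
qed

text \<open>A root cannot recur below itself, because levels increase. A vertex common to two
  sibling subtrees would have two different ancestors at the level of the siblings, against
  uniqueness of ancestors.\<close>

lemma distinct_preorder:
  assumes T: "rooted_tree T" and "embeds (edges T) L" "root_label L \<in> vertices T"
  shows "distinct (preorder L)"
  using assms(2,3)
proof (induction L)
  case (Node v Ls)
  have child: "(v, root_label L) \<in> edges T" "root_label L \<in> vertices T" "embeds (edges T) L"
    if "L \<in> set Ls" for L
    using Node.prems that T by (auto simp: rooted_tree_def)
  have level: "level T (root_label L) = Suc (level T v)" if "L \<in> set Ls" for L
    using level_edge[OF T child(1)[OF that]] .
  have below: "\<exists>k. (root_label L, w) \<in> edges T ^^ k" if "L \<in> set Ls" "w \<in> set_ptree L" for L w
    using embeds_set_ptree[OF child(3)[OF that(1)]] that(2) by (auto simp: rtrancl_power)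
  have "v \<notin> set_ptree L" if L: "L \<in> set Ls" for L
  proof
    assume "v \<in> set_ptree L"
    with below[OF L] obtain k where "(root_label L, v) \<in> edges T ^^ k" by blast
    from level_path[OF T child(2)[OF L] this] level[OF L] show False by simp
  qed
  moreover have disj: "set_ptree L \<inter> set_ptree L' = {}"
    if L: "L \<in> set Ls" and L': "L' \<in> set Ls" and "root_label L \<noteq> root_label L'" for L L'
  proof (rule ccontr)
    assume "set_ptree L \<inter> set_ptree L' \<noteq> {}"
    then obtain w j k where w: "(root_label L, w) \<in> edges T ^^ j" "(root_label L', w) \<in> edges T ^^ k"
      using below L L' by blast
    have "j = k"
      using level_path[OF T child(2)[OF L] w(1)] level_path[OF T child(2)[OF L'] w(2)]
        level[OF L] level[OF L'] by simp
    with w ancestor_unique[OF T] that(3) show False by blast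
  qed
  have "distinct (concat (map preorder Ls))"
  proof (rule distinct_concat)
    \<comment> \<open>Each preorder starts with its root label, so distinct roots make the preorders
      distinct as lists.\<close>
    have "map root_label Ls = map hd (map preorder Ls)"
    proof -
      have "root_label L = hd (preorder L)" for L :: "'a ptree" by (cases L) simp
      then show ?thesis by simp
    qed
    then have "distinct (map hd (map preorder Ls))"
      using Node.prems by (metis embeds.simps)
    then show "distinct (map preorder Ls)"
      unfolding distinct_map[of hd] by blast
    show "distinct ys" if "ys \<in> set (map preorder Ls)" for ys
      using that Node.IH child by auto
    show "set ys \<inter> set zs = {}" if ys: "ys \<in> set (map preorder Ls)"
      and zs: "zs \<in> set (map preorder Ls)" and "ys \<noteq> zs" for ys zs
    proof -
      obtain L L' where L: "L \<in> set Ls" "L' \<in> set Ls" "ys = preorder L" "zs = preorder L'"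
        using ys zs by auto
      with \<open>ys \<noteq> zs\<close> have "L \<noteq> L'" by auto
      moreover have "inj_on root_label (set Ls)"
        using Node.prems by (simp add: distinct_map)
      ultimately have "root_label L \<noteq> root_label L'"
        using L by (auto dest: inj_onD)
      with L disj show ?thesis by simp
    qed
  qed
  ultimately show ?case by auto
qed

lemma embeddingsD:
  assumes "rooted_tree T" "L \<in> embeddings T"
  shows "embeds (edges T) L" "root_label L = tree_root T" "set_ptree L = vertices T"
    "distinct (preorder L)"
proof -
  show 1: "embeds (edges T) L" "root_label L = tree_root T"
    using assms(2) by (auto simp: embeddings_at_def)
  then show "set_ptree L = vertices T"
    using embeds_set_ptree[OF 1(1)] vertices_eq_reachable[OF assms(1)] by simp
  show "distinct (preorder L)"
    using assms(1) 1 by (intro distinct_preorder) (auto simp: rooted_tree_def)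
qed

text \<open>Well-founded induction along reversed edges provides embeddings below all children;
  listing the finitely many children in any order joins them.\<close>

lemma ex_embedding:
  assumes "rooted_tree T"
  shows "embeddings T \<noteq> {}"
proof -
  have "embeddings_at (edges T) v \<noteq> {}" for v
    using wf_converse_edges[OF assms]
  proof (induction v rule: wf_induct_rule)
    case (less v)
    then have "\<forall>w \<in> edges T `` {v}. \<exists>L. L \<in> embeddings_at (edges T) w" by auto
    then obtain e where e: "\<And>w. w \<in> edges T `` {v} \<Longrightarrow> e w \<in> embeddings_at (edges T) w"
      by metis
    obtain ws where ws: "set ws = edges T `` {v}" "distinct ws"
      using finite_distinct_list[OF finite_children[OF assms]] by blast
    have e': "root_label (e w) = w" "embeds (edges T) (e w)" if "w \<in> set ws" for w
      using e that ws by (auto simp: embeddings_at_def)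
    have "map (root_label \<circ> e) ws = ws"
      using e' by (auto intro: map_idI)
    moreover from this have "root_label ` e ` set ws = set ws"
      by (metis list.set_map image_comp)
    ultimately have "Node v (map e ws) \<in> embeddings_at (edges T) v"
      using e' ws by (simp add: embeddings_at_def)
    then show ?case by blast
  qed
  then show ?thesis .
qed

section \<open>Isomorphisms acting on embeddings\<close>

lemma is_tree_iso_children:
  assumes "rooted_tree T" "rooted_tree T'" "is_tree_iso f T T'" "v \<in> vertices T"
  shows "edges T' `` {f v} = f ` (edges T `` {v})"
proof (intro equalityI subsetI)
  fix w' assume w': "w' \<in> edges T' `` {f v}"
  then have "w' \<in> f ` vertices T"
    using assms(2,3) by (auto simp: rooted_tree_def is_tree_iso_def bij_betw_def)
  then obtain w where "w \<in> vertices T" "w' = f w" by blast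
  with w' assms(3,4) show "w' \<in> f ` (edges T `` {v})"
    by (auto simp: is_tree_iso_def)
next
  fix w' assume "w' \<in> f ` (edges T `` {v})"
  then obtain w where "w' = f w" "(v, w) \<in> edges T" "w \<in> vertices T"
    using assms(1) by (auto simp: rooted_tree_def)
  with assms(3,4) show "w' \<in> edges T' `` {f v}"
    by (auto simp: is_tree_iso_def)
qed

lemma map_ptree_in_embeddings:
  assumes "rooted_tree T" "rooted_tree T'" "is_tree_iso f T T'" "L \<in> embeddings T"
  shows "map_ptree f L \<in> embeddings T'"
proof -
  note L = embeddingsD[OF assms(1,4)]
  have "embeds (edges T') (map_ptree f L)"
    by (rule embeds_map[OF L(1), where A = "vertices T"])
       (use assms(3) L(3) is_tree_iso_children[OF assms(1-3)] in \<open>auto simp: is_tree_iso_def bij_betw_def\<close>)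
  then show ?thesis
    using assms(3) L(2) by (simp add: embeddings_at_def is_tree_iso_def)
qed

lemma embeds_map_children:
  assumes "embeds E L" "embeds E' (map_ptree f L)" "v \<in> set_ptree L"
  shows "E' `` {f v} = f ` (E `` {v})"
  using assms
proof (induction L)
  case (Node u Ls)
  show ?case
  proof (cases "v = u")
    case True
    have "E' `` {f u} = root_label ` map_ptree f ` set Ls" "E `` {u} = root_label ` set Ls"
      using Node.prems by auto
    with True show ?thesis by (simp add: image_image)
  qed (use Node in auto)
qed

text \<open>Matching the two plane trees position by position carries children to children, hence is
  an isomorphism. A single common shape therefore certifies that two trees are isomorphic.\<close>

lemma ex_tree_iso_of_shape_eq:
  assumes T: "rooted_tree T" and T': "rooted_tree T'"
    and L: "L \<in> embeddings T" and L': "L' \<in> embeddings T'" and "shape L = shape L'"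
  shows "\<exists>f. is_tree_iso f T T' \<and> map_ptree f L = L'"
proof -
  note L = embeddingsD[OF T L] and L' = embeddingsD[OF T' L']
  obtain f where f: "map_ptree f L = L'" and "bij_betw f (set_ptree L) (set_ptree L')"
    using ex_map_ptree_eq[OF L(4) L'(4) \<open>shape L = shape L'\<close>] by blast
  then have bij: "bij_betw f (vertices T) (vertices T')" by (simp add: L L')
  have children: "edges T' `` {f v} = f ` (edges T `` {v})" if "v \<in> vertices T" for v
    using embeds_map_children[OF L(1), of _ f v] L'(1) f that L(3) by simp
  have "(u, v) \<in> edges T \<longleftrightarrow> (f u, f v) \<in> edges T'" if u: "u \<in> vertices T" and v: "v \<in> vertices T" for u v
  proof -
    have "(f u, f v) \<in> edges T' \<longleftrightarrow> f v \<in> f ` (edges T `` {u})"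
      using children[OF u] by auto
    also have "\<dots> \<longleftrightarrow> v \<in> edges T `` {u}"
      using bij v T by (intro inj_on_image_mem_iff[of f "vertices T"])
        (auto simp: bij_betw_def rooted_tree_def)
    finally show ?thesis by simp
  qed
  moreover have "f (tree_root T) = tree_root T'"
    using L(2) L'(2) f by auto
  ultimately show ?thesis using bij f by (auto simp: is_tree_iso_def)
qed

text \<open>The action is free because the labels of \<open>L\<close> exhaust the vertices, so the
  relabelled \<open>L\<close> determines the automorphism. It is transitive on embeddings of one
  shape by matching positions.\<close>

lemma tree_aut_bij_embeddings:
  assumes T: "rooted_tree T" and L: "L \<in> embeddings T"
  shows "bij_betw (\<lambda>f. map_ptree f L) (tree_aut T) {L' \<in> embeddings T. shape L' = shape L}"
  unfolding bij_betw_def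
proof (intro conjI equalityI subsetI)
  note LD = embeddingsD[OF T L]
  show "inj_on (\<lambda>f. map_ptree f L) (tree_aut T)"
  proof (rule inj_onI)
    fix f g assume f: "f \<in> tree_aut T" and g: "g \<in> tree_aut T" and "map_ptree f L = map_ptree g L"
    then have "map f (preorder L) = map g (preorder L)"
      by (metis preorder_map)
    then have "f x = g x" if "x \<in> vertices T" for x
      using that LD(3) by auto
    moreover have "f x = g x" if "x \<notin> vertices T" for x
      using permutes_not_in[of f, OF _ that] permutes_not_in[of g, OF _ that] f g
      by (auto simp: tree_aut_def)
    ultimately show "f = g" by blast
  qed
  show "L' \<in> {L' \<in> embeddings T. shape L' = shape L}" if "L' \<in> (\<lambda>f. map_ptree f L) ` tree_aut T" for L'
    using that map_ptree_in_embeddings[OF T T _ L] by (auto simp: tree_aut_def ptree.map_comp o_def)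
  show "L' \<in> (\<lambda>f. map_ptree f L) ` tree_aut T" if "L' \<in> {L' \<in> embeddings T. shape L' = shape L}" for L'
  proof -
    from that ex_tree_iso_of_shape_eq[OF T T L, of L'] obtain f
      where f: "is_tree_iso f T T" "map_ptree f L = L'" by auto
    \<comment> \<open>The isomorphism \<open>f\<close> is controlled on the vertices only;
      \<open>tree_aut\<close> wants the identity elsewhere.\<close>
    define g where "g x = (if x \<in> vertices T then f x else x)" for x
    have "bij_betw g (vertices T) (vertices T)"
      using f(1) by (auto simp: is_tree_iso_def g_def cong: bij_betw_cong)
    then have "g permutes vertices T"
      by (rule bij_imp_permutes) (simp add: g_def)
    moreover have "is_tree_iso g T T"
      using f(1) \<open>bij_betw g _ _\<close> T by (auto simp: is_tree_iso_def g_def rooted_tree_def)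
    moreover have "map_ptree g L = L'"
      unfolding f(2)[symmetric] by (rule ptree.map_cong) (auto simp: g_def LD)
    ultimately show ?thesis by (auto simp: tree_aut_def)
  qed
qed

text \<open>If there are N embeddings, every shape has weight 1/N and comes from exactly |Aut|
  embeddings, so there are N/|Aut| shapes.\<close>

lemma sum_weight_shapes:
  assumes T: "rooted_tree T"
  shows "(\<Sum>P \<in> shape ` embeddings T. weight P) = 1 / of_nat (card (tree_aut T))"
proof -
  let ?N = "of_nat (card (embeddings T)) :: rat" and ?a = "card (tree_aut T)"
  have "finite (embeddings T) \<and> ?N * weight L = 1" if "L \<in> embeddings T" for L
    using card_embeddings_at[of "edges T" L] embeddingsD[OF T that] by simp
  with ex_embedding[OF T] have fin: "finite (embeddings T)"
    and w: "\<And>L. L \<in> embeddings T \<Longrightarrow> ?N * weight L = 1" by auto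
  have "?N \<noteq> 0" using ex_embedding[OF T] fin by simp
  have fibre: "card {L' \<in> embeddings T. shape L' = P} = ?a" if "P \<in> shape ` embeddings T" for P
    using that bij_betw_same_card[OF tree_aut_bij_embeddings[OF T]] by fastforce
  have "card (embeddings T) = (\<Sum>P \<in> shape ` embeddings T. card {L' \<in> embeddings T. shape L' = P})"
    unfolding card_eq_sum by (rule sum.image_gen[OF fin])
  also have "\<dots> = card (shape ` embeddings T) * ?a"
    by (simp add: fibre)
  finally have N: "?N = of_nat (card (shape ` embeddings T)) * of_nat ?a"
    by simp
  have "(\<Sum>P \<in> shape ` embeddings T. weight P) = (\<Sum>P \<in> shape ` embeddings T. 1 / ?N)"
  proof (rule sum.cong)
    fix P assume "P \<in> shape ` embeddings T"
    then obtain L where "L \<in> embeddings T" "P = shape L" by blast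
    with w[of L] \<open>?N \<noteq> 0\<close> show "weight P = 1 / ?N" by (simp add: field_simps)
  qed simp
  also have "\<dots> = of_nat (card (shape ` embeddings T)) / ?N"
    by simp
  also have "\<dots> = 1 / of_nat ?a"
    using N \<open>?N \<noteq> 0\<close> by (simp add: field_simps)
  finally show ?thesis .
qed

text \<open>Were the cardinality 0, its reciprocal would be 0 by convention, whereas
  \<open>sum_weight_shapes\<close> equates it with a nonempty sum of positive weights.\<close>

lemma card_tree_aut_nonzero:
  assumes "rooted_tree T"
  shows "card (tree_aut T) \<noteq> 0"
proof -
  have "finite (shape ` embeddings T)"
  proof -
    obtain L where "L \<in> embeddings T" using ex_embedding[OF assms] by blast
    then show ?thesis
      using card_embeddings_at[of "edges T" L] embeddingsD[OF assms] by auto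
  qed
  then have "(\<Sum>P \<in> shape ` embeddings T. weight P) > 0"
    using ex_embedding[OF assms] by (intro sum_pos) (auto simp: weight_pos)
  then show ?thesis
    by (auto simp: sum_weight_shapes[OF assms])
qed

section \<open>Monomial, leaves and tails read off from an embedding\<close>

lemma card_out_edges: "card (out_edges T v) = card (edges T `` {v})"
proof -
  have "out_edges T v = Pair v ` (edges T `` {v})"
    by (auto simp: out_edges_def)
  then show ?thesis by (simp add: card_image inj_on_def)
qed

lemma out_edges_empty_iff: "out_edges T v = {} \<longleftrightarrow> edges T `` {v} = {}"
  by (auto simp: out_edges_def)

lemma embeds_card_children:
  assumes "embeds E (Node v Ls)"
  shows "card (E `` {v}) = length Ls"
  using assms distinct_card[of "map root_label Ls"] by simp

lemma monomial_Node [simp]: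
  "monomial (Node v Ls) l = replicate_mset (length Ls - 1) l + (\<Sum>L \<leftarrow> Ls. monomial L (Suc l))"
  by (simp add: o_def)

declare monomial.simps [simp del]

text \<open>Formulated for the embedding of any subtree, started at the level of its root, so that
  the induction can descend to children one level deeper.\<close>

lemma monomial_embeds:
  assumes "rooted_tree T" "embeds (edges T) L"
  shows "monomial L (level T (root_label L)) =
    (\<Sum>v \<leftarrow> preorder L. replicate_mset (card (edges T `` {v}) - 1) (level T v))"
  using assms(2)
proof (induction L)
  case (Node v Ls)
  have "monomial L (Suc (level T v)) =
      (\<Sum>v \<leftarrow> preorder L. replicate_mset (card (edges T `` {v}) - 1) (level T v))"
    if "L \<in> set Ls" for L
  proof -
    have "(v, root_label L) \<in> edges T" using Node.prems that by auto
    then show ?thesis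
      using Node.IH[OF that] Node.prems level_edge[OF assms(1)] that by simp
  qed
  moreover have "(\<Sum>v \<leftarrow> concat (map preorder Ms). f v) = (\<Sum>L \<leftarrow> Ms. \<Sum>v \<leftarrow> preorder L. f v)"
    for Ms and f :: "'a \<Rightarrow> nat multiset"
    by (induction Ms) auto
  ultimately show ?case
    using embeds_card_children[OF Node.prems] by (simp cong: map_cong)
qed

lemma monomial_embedding:
  assumes T: "rooted_tree T" and L: "L \<in> embeddings T"
  shows "monomial L 1 =
    (\<Sum>v \<in> vertices T - leaves T. replicate_mset (card (out_edges T v) - 1) (level T v))"
proof -
  note LD = embeddingsD[OF T L]
  have "monomial L 1 = (\<Sum>v \<in> vertices T. replicate_mset (card (edges T `` {v}) - 1) (level T v))"
    using monomial_embeds[OF T LD(1)] sum.distinct_set_conv_list[OF LD(4), of "\<lambda>v. replicate_mset (card (edges T `` {v}) - 1) (level T v)"]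
    by (simp add: LD(2,3) level_root[OF T])
  \<comment> \<open>A leaf has no outgoing edges, and \<open>0 - 1 = 0\<close> on naturals, so its
    term is empty and may be dropped.\<close>
  also have "\<dots> = (\<Sum>v \<in> vertices T - leaves T. replicate_mset (card (out_edges T v) - 1) (level T v))"
    using T by (intro sum.mono_neutral_cong_right)
      (auto simp: rooted_tree_def card_out_edges leaves_def out_edges_empty_iff)
  finally show ?thesis .
qed

lemma tree_term_eq:
  assumes "rooted_tree T" "L \<in> embeddings T"
  shows "tree_term T = mfps_const (1 / of_nat (card (tree_aut T))) * mfps_monom (monomial L 1)"
  by (simp only: tree_term_def mfps_var_power prod_mfps_monom monomial_embedding[OF assms])

lemma num_leaves_eq_filter:
  assumes "embeds E L"
  shows "num_leaves L = length (filter (\<lambda>w. E `` {w} = {}) (preorder L))"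
  using assms
proof (induction L)
  case (Node v Ls)
  then have "num_leaves L = length (filter (\<lambda>w. E `` {w} = {}) (preorder L))" if "L \<in> set Ls" for L
    using that by simp
  moreover have "E `` {v} = {} \<longleftrightarrow> Ls = []"
    using Node.prems by auto
  ultimately show ?case
    by (simp add: filter_concat length_concat o_def cong: map_cong)
qed

lemma card_leaves_below:
  assumes T: "rooted_tree T" and L: "embeds (edges T) L" "root_label L \<in> vertices T"
  shows "card {w \<in> leaves T. (root_label L, w) \<in> (edges T)\<^sup>*} = num_leaves L"
proof -
  have "{w \<in> leaves T. (root_label L, w) \<in> (edges T)\<^sup>*} =
      set (filter (\<lambda>w. edges T `` {w} = {}) (preorder L))"
    using embeds_set_ptree[OF L(1)] reachable_in_vertices[OF T L(2)]
    by (auto simp: leaves_def out_edges_empty_iff)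
  moreover have "distinct (filter (\<lambda>w. edges T `` {w} = {}) (preorder L))"
    using distinct_preorder[OF assms] by simp
  ultimately show ?thesis
    using num_leaves_eq_filter[OF L(1)] by (metis distinct_card)
qed

lemma no_tails_iff:
  assumes "rooted_tree T" "embeds (edges T) L" "root_label L \<in> vertices T"
  shows "no_tails L \<longleftrightarrow> (\<forall>v \<in> set_ptree L. \<not> trivial_tail_at T v)"
  using assms(2,3)
proof (induction L)
  case (Node v Ls)
  have root: "trivial_tail_at T v \<longleftrightarrow> length Ls = 1 \<and> num_leaves (Node v Ls) = 1"
    using card_leaves_below[OF assms(1) Node.prems] Node.prems(2)
    by (simp only: trivial_tail_at_def card_out_edges embeds_card_children[OF Node.prems(1)] ptree.sel simp_thms)
  have "no_tails L \<longleftrightarrow> (\<forall>w \<in> set_ptree L. \<not> trivial_tail_at T w)" if "L \<in> set Ls" for L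
  proof -
    have "(v, root_label L) \<in> edges T" using Node.prems that by auto
    then have "root_label L \<in> vertices T" using assms(1) by (auto simp: rooted_tree_def)
    moreover have "embeds (edges T) L" using Node.prems(1) that by simp
    ultimately show ?thesis by (intro Node.IH[OF that])
  qed
  then have "(\<forall>L \<in> set Ls. no_tails L) \<longleftrightarrow> (\<forall>L \<in> set Ls. \<forall>w \<in> set_ptree L. \<not> trivial_tail_at T w)"
    by (intro ball_cong refl)
  with root show ?case
    by (simp only: no_tails.simps ptree.set ball_Un UN_ball_bex_simps ball_simps simp_thms)
qed

text \<open>Among trees free of tails only the single leaf has fewer than two leaves, so the bound
  on leaves turns into the existence of a child of the root.\<close>

lemma minimal_trees_iff:
  assumes T: "rooted_tree T" and L: "L \<in> embeddings T"
  shows "T \<in> minimal_trees \<longleftrightarrow> no_tails L \<and> subtrees L \<noteq> []"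
proof -
  note LD = embeddingsD[OF T L]
  have root: "root_label L \<in> vertices T" using LD(2) T by (simp add: rooted_tree_def)
  have "(root_label L, w) \<in> (edges T)\<^sup>*" if "w \<in> leaves T" for w
    using that T unfolding LD(2) leaves_def rooted_tree_def by blast
  then have "{w \<in> leaves T. (root_label L, w) \<in> (edges T)\<^sup>*} = leaves T"
    by blast
  with card_leaves_below[OF T LD(1) root] have "card (leaves T) = num_leaves L"
    by (simp only:)
  moreover have "(\<nexists>v. trivial_tail_at T v) \<longleftrightarrow> no_tails L"
    unfolding no_tails_iff[OF T LD(1) root] LD(3) by (auto simp: trivial_tail_at_def)
  ultimately have "T \<in> minimal_trees \<longleftrightarrow> no_tails L \<and> num_leaves L \<ge> 2"
    using T unfolding minimal_trees_def mem_Collect_eq by presburger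
  then show ?thesis
    using num_leaves_ge_2_iff[of L] by blast
qed

section \<open>Rooted trees with a prescribed plane shape\<close>

primrec edges_of :: "'n ptree \<Rightarrow> ('n \<times> 'n) set" where
  "edges_of (Node v Ls) = Pair v ` root_label ` set Ls \<union> \<Union> (set (map edges_of Ls))"

definition tree_of :: "'n ptree \<Rightarrow> 'n tree" where
  "tree_of L = \<lparr>vertices = set_ptree L, edges = edges_of L, tree_root = root_label L\<rparr>"

lemma distinct_preorder_NodeD:
  assumes "distinct (preorder (Node v Ls))"
  shows "distinct (map root_label Ls)"
    and "\<And>L. L \<in> set Ls \<Longrightarrow> v \<notin> set_ptree L"
    and "\<And>L. L \<in> set Ls \<Longrightarrow> distinct (preorder L)"
    and "\<And>L L' w. L \<in> set Ls \<Longrightarrow> L' \<in> set Ls \<Longrightarrow> w \<in> set_ptree L \<Longrightarrow> w \<in> set_ptree L' \<Longrightarrow> L = L'"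
proof -
  have nonempty: "preorder L \<noteq> []" for L :: "'a ptree"
    by (cases L) simp
  have *: "distinct (concat (map preorder Ls))" using assms by simp
  show "v \<notin> set_ptree L" "distinct (preorder L)" if "L \<in> set Ls" for L
    using assms that by (auto simp: distinct_concat_iff)
  \<comment> \<open>\<open>distinct_concat_iff\<close> ignores empty lists; no preorder is empty, so
    it yields full distinctness here.\<close>
  have "removeAll [] (map preorder Ls) = map preorder Ls"
    using nonempty by (induction Ls) (auto simp: neq_commute)
  then have dist: "distinct (map preorder Ls)"
    using * by (simp add: distinct_concat_iff)
  show disj: "L = L'" if "L \<in> set Ls" "L' \<in> set Ls" "w \<in> set_ptree L" "w \<in> set_ptree L'" for L L' w
  proof (rule ccontr)
    assume "L \<noteq> L'"
    then have "preorder L \<noteq> preorder L'"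
      using dist that by (auto simp: distinct_map dest: inj_onD)
    from * have disjoint: "set ys \<inter> set zs = {}"
      if "ys \<in> set (map preorder Ls)" "zs \<in> set (map preorder Ls)" "ys \<noteq> zs" for ys zs
      using that unfolding distinct_concat_iff by blast
    have "set (preorder L) \<inter> set (preorder L') = {}"
      by (rule disjoint) (use that(1,2) \<open>preorder L \<noteq> preorder L'\<close> in auto)
    with that show False by auto
  qed
  have "inj_on root_label (set Ls)"
    using disj by (metis inj_onI root_label_in_set)
  with dist show "distinct (map root_label Ls)"
    by (simp add: distinct_map)
qed

lemma edges_of_subset:
  assumes "distinct (preorder L)"
  shows "edges_of L \<subseteq> set_ptree L \<times> (set_ptree L - {root_label L})"
  using assms
proof (induction L)
  case (Node v Ls)
  note D = distinct_preorder_NodeD[OF Node.prems]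
  have "edges_of L \<subseteq> set_ptree L \<times> set_ptree L" "v \<notin> set_ptree L" if "L \<in> set Ls" for L
    using Node.IH[OF that D(3)[OF that]] D(2)[OF that] by auto
  moreover have "root_label L \<noteq> v" if "L \<in> set Ls" for L
    using D(2)[OF that] root_label_in_set[of L] by metis
  ultimately show ?case by fastforce
qed

lemma embeds_edges_of:
  assumes "distinct (preorder L)"
  shows "embeds (edges_of L) L"
  using assms
proof (induction L)
  case (Node v Ls)
  note D = distinct_preorder_NodeD[OF Node.prems]
  have sub: "edges_of L \<subseteq> set_ptree L \<times> set_ptree L" if "L \<in> set Ls" for L
    using edges_of_subset[OF D(3)[OF that]] by auto
  have "edges_of (Node v Ls) `` {v} = root_label ` set Ls"
    using sub D(2) by fastforce
  moreover have "embeds (edges_of (Node v Ls)) L" if L: "L \<in> set Ls" for L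
  proof -
    \<comment> \<open>Labels are distinct, so no edge outside \<open>L\<close> starts at a vertex of
      \<open>L\<close>, and \<open>embeds_cong\<close> applies.\<close>
    have "edges_of L `` {u} = edges_of (Node v Ls) `` {u}" if u: "u \<in> set_ptree L" for u
    proof -
      have "w \<in> edges_of L `` {u}" if w: "(u, w) \<in> edges_of (Node v Ls)" for w
      proof -
        have "u \<noteq> v" using D(2)[OF L] u by blast
        with w obtain L' where L': "L' \<in> set Ls" "(u, w) \<in> edges_of L'" by auto
        then have "L' = L" using D(4)[OF L'(1) L _ u] sub by blast
        with L' show ?thesis by simp
      qed
      then show ?thesis using L by auto
    qed
    then show ?thesis
      using Node.IH[OF L D(3)[OF L]] embeds_cong[of L "edges_of L" "edges_of (Node v Ls)"] by blast
  qed
  ultimately show ?case using D(1) by simp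
qed

text \<open>If \<open>w\<close> is a child of the root, no edge inside a subtree enters it, as roots
  of subtrees have no incoming edge there. Otherwise both edges lie in the one subtree containing
  \<open>w\<close>.\<close>

lemma edges_of_parent_unique:
  assumes "distinct (preorder L)" "(u, w) \<in> edges_of L" "(u', w) \<in> edges_of L"
  shows "u = u'"
  using assms
proof (induction L)
  case (Node v Ls)
  note D = distinct_preorder_NodeD[OF Node.prems(1)]
  have sub: "edges_of L \<subseteq> set_ptree L \<times> (set_ptree L - {root_label L})" if "L \<in> set Ls" for L
    using edges_of_subset[OF D(3)[OF that]] .
  have no_root: "(x, w) \<notin> edges_of L" if "L \<in> set Ls" "w \<in> root_label ` set Ls" for L x
  proof
    assume x: "(x, w) \<in> edges_of L"
    from that obtain L' where L': "L' \<in> set Ls" "w = root_label L'" by blast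
    have "L' = L"
      using D(4)[OF L'(1) that(1)] root_label_in_set[of L'] L'(2) x sub[OF that(1)] by blast
    with L' x sub[OF that(1)] show False by auto
  qed
  show ?case
  proof (cases "w \<in> root_label ` set Ls")
    case True
    then show ?thesis using Node.prems(2,3) no_root by auto
  next
    case False
    then obtain L L' where L: "L \<in> set Ls" "(u, w) \<in> edges_of L" and L': "L' \<in> set Ls" "(u', w) \<in> edges_of L'"
      using Node.prems(2,3) by auto
    moreover have "L = L'"
      using D(4)[OF L(1) L'(1)] L L' sub by blast
    ultimately show ?thesis using Node.IH[OF L(1) D(3)[OF L(1)]] by simp
  qed
qed

lemma rooted_tree_of:
  assumes "distinct (preorder L)"
  shows "rooted_tree (tree_of L)"
proof -
  note reach = embeds_set_ptree[OF embeds_edges_of[OF assms]]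
  have "\<exists>!u. (u, v) \<in> edges_of L" if v: "v \<in> set_ptree L - {root_label L}" for v
  proof -
    have "(root_label L, v) \<in> (edges_of L)\<^sup>*" using v reach by auto
    then obtain u where "(u, v) \<in> edges_of L"
      using v by (auto elim: rtranclE)
    then show ?thesis using edges_of_parent_unique[OF assms] by blast
  qed
  moreover have "finite (set_ptree L)"
    by (metis List.finite_set set_preorder)
  ultimately show ?thesis
    using edges_of_subset[OF assms] reach by (auto simp: rooted_tree_def tree_of_def)
qed

text \<open>Numbering the vertices in preorder gives distinct labels, and \<open>tree_of\<close>
  then realises the shape.\<close>

lemma ex_tree_with_shape:
  fixes P :: "unit ptree"
  shows "\<exists>T :: nat tree. rooted_tree T \<and> P \<in> shape ` embeddings T"
proof -
  obtain L where L: "shape L = shape P" "preorder L = [0..<length (preorder P)]"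
    using ex_ptree_with_labels[of "[0..<length (preorder P)]" P] by auto
  then have "distinct (preorder L)" by simp
  then have "rooted_tree (tree_of L)" "L \<in> embeddings (tree_of L)"
    using rooted_tree_of embeds_edges_of by (auto simp: tree_of_def embeddings_at_def)
  moreover have "shape P = P"
    by (simp add: ptree.map_ident_strong)
  ultimately show ?thesis using L(1) by (metis image_eqI)
qed


section \<open>The series as a sum over plane trees\<close>

lemma in_sum_list_mset_iff: "x \<in># (\<Sum>y \<leftarrow> ys. f y) \<longleftrightarrow> (\<exists>y \<in> set ys. x \<in># f y)"
  by (induction ys) auto

lemma monomial_level_ge: "x \<in># monomial P l \<Longrightarrow> l \<le> x"
proof (induction P arbitrary: l)
  case (Node v Ps)
  then consider "x \<in># replicate_mset (length Ps - 1) l"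
    | P where "P \<in> set Ps" "x \<in># monomial P (Suc l)"
    by (auto simp: in_sum_list_mset_iff)
  then show ?case
    by cases (use Node.IH in \<open>force split: if_splits\<close>)+
qed

lemma monomial_subtree: "P \<in> set Ps \<Longrightarrow> monomial P (Suc l) \<subseteq># monomial (Node v Ps) l"
  by (auto dest!: split_list)

text \<open>Levels enter only through the starting value, so starting one level deeper is the index
  shift that the recursion applies to \<open>p_A\<close>.\<close>

lemma monomial_shift: "monomial P (Suc l) = image_mset Suc (monomial P l)"
proof (induction P arbitrary: l)
  case (Node v Ps)
  have "(\<Sum>P \<leftarrow> Qs. monomial P (Suc (Suc l))) = image_mset Suc (\<Sum>P \<leftarrow> Qs. monomial P (Suc l))"
    if "set Qs \<subseteq> set Ps" for Qs
    using that Node by (induction Qs) auto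
  then show ?case by simp
qed

text \<open>An empty monomial leaves at most one child everywhere. By induction an only child would
  be a leaf, and that is the excluded tail.\<close>

lemma monomial_eq_empty:
  fixes P :: "unit ptree"
  assumes "no_tails P" "monomial P l = {#}"
  shows "P = Node () []"
  using assms
proof (induction P arbitrary: l)
  case (Node u Ps)
  have "length Ps \<le> 1" using Node.prems(2) by simp
  then consider "Ps = []" | P where "Ps = [P]"
    by (cases Ps) auto
  then show ?case
  proof cases
    case 2
    then have "P = Node () []"
      using Node.IH[of P "Suc l"] Node.prems by (simp add: no_tails_Node del: no_tails.simps)
    with 2 Node.prems(1) show ?thesis by simp
  qed simp
qed

text \<open>\<open>N\<close> counts the levels from \<open>l\<close> on that the variables of
  \<open>m\<close> may occupy. With no level left only the single leaf remains; otherwise the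
  children start one level deeper, have monomials dividing \<open>m\<close>, and have one level
  fewer at their disposal.\<close>

lemma finite_no_tails_monomial:
  assumes "\<And>x. x \<in># m \<Longrightarrow> x < l + N"
  shows "finite {P :: unit ptree. no_tails P \<and> monomial P l = m}"
  using assms
proof (induction N arbitrary: l m)
  case 0
  have "{P :: unit ptree. no_tails P \<and> monomial P l = m} \<subseteq> {Node () []}"
  proof
    fix P :: "unit ptree" assume P: "P \<in> {P. no_tails P \<and> monomial P l = m}"
    have "m = {#}"
    proof (rule ccontr)
      assume "m \<noteq> {#}"
      then obtain x where "x \<in># m" by blast
      with 0 P monomial_level_ge[of x P l] show False by fastforce
    qed
    with P monomial_eq_empty show "P \<in> {Node () []}" by blast
  qed
  then show ?case by (rule finite_subset) simp
next
  case (Suc N)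
  let ?S = "\<Union>m' \<in> {m'. m' \<subseteq># m}. {P :: unit ptree. no_tails P \<and> monomial P (Suc l) = m'}"
  have "finite {P :: unit ptree. no_tails P \<and> monomial P (Suc l) = m'}" if "m' \<subseteq># m" for m'
    using Suc.prems mset_subset_eqD[OF that] by (intro Suc.IH) auto
  then have S: "finite ?S" by (simp add: finite_submultisets)
  \<comment> \<open>A root with \<open>k\<close> children contributes \<open>k - 1\<close> copies of
    \<open>l\<close>, which bounds \<open>k\<close> by \<open>Suc (size m)\<close>.\<close>
  have "{P :: unit ptree. no_tails P \<and> monomial P l = m} \<subseteq>
      Node () ` {Ps. set Ps \<subseteq> ?S \<and> length Ps \<le> Suc (size m)}"
  proof
    fix P :: "unit ptree" assume P: "P \<in> {P. no_tails P \<and> monomial P l = m}"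
    obtain Ps where Ps: "P = Node () Ps" by (cases P) auto
    have "length Ps \<le> Suc (size m)" using P Ps by auto
    moreover have "set Ps \<subseteq> ?S"
      using P Ps monomial_subtree[of _ Ps l "()"] by (auto simp del: monomial_Node)
    ultimately show "P \<in> Node () ` {Ps. set Ps \<subseteq> ?S \<and> length Ps \<le> Suc (size m)}"
      using Ps by blast
  qed
  then show ?case
    by (rule finite_subset) (intro finite_imageI finite_lists_length_le[OF S])
qed

lemma locally_finite_no_tails:
  "locally_finite (\<lambda>P. monomial P l) {P :: unit ptree. no_tails P}"
  unfolding locally_finite_def
proof
  fix m :: "nat multiset"
  have "x < l + Suc (Max (set_mset m))" if "x \<in># m" for x
    using Max_ge[OF _ that] by simp
  from finite_no_tails_monomial[of m l, OF this]
  show "finite {P \<in> {P :: unit ptree. no_tails P}. monomial P l = m}" by simp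
qed

section \<open>Isomorphism classes named by plane shapes\<close>

lemma is_tree_iso_shapes:
  assumes "rooted_tree T" "rooted_tree T'" "is_tree_iso f T T'"
  shows "shape ` embeddings T \<subseteq> shape ` embeddings T'"
proof
  fix P assume "P \<in> shape ` embeddings T"
  then obtain L where L: "L \<in> embeddings T" "P = shape L" by blast
  then have "P = shape (map_ptree f L)"
    by (simp add: ptree.map_comp o_def)
  with map_ptree_in_embeddings[OF assms L(1)] show "P \<in> shape ` embeddings T'" by blast
qed

lemma ex_tree_iso_iff:
  assumes T: "rooted_tree T" and T': "rooted_tree T'" and P: "P \<in> shape ` embeddings T"
  shows "(\<exists>f. is_tree_iso f T T') \<longleftrightarrow> P \<in> shape ` embeddings T'"
proof
  assume "P \<in> shape ` embeddings T'"
  with P obtain L L' where "L \<in> embeddings T" "L' \<in> embeddings T'" "shape L = shape L'"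
    by auto
  from ex_tree_iso_of_shape_eq[OF T T' this] show "\<exists>f. is_tree_iso f T T'" by blast
qed (use is_tree_iso_shapes[OF T T'] P in blast)

text \<open>A shape names all minimal trees that can be drawn that way; by
  \<open>ex_tree_iso_iff\<close> these form one isomorphism class or none.\<close>

definition class_of :: "unit ptree \<Rightarrow> nat tree set" where
  "class_of P = {T \<in> minimal_trees. P \<in> shape ` embeddings T}"

lemma minimal_treesD: "T \<in> minimal_trees \<Longrightarrow> rooted_tree T"
  by (simp add: minimal_trees_def)

lemma minimal_trees_shape:
  assumes "rooted_tree T" "P \<in> shape ` embeddings T"
  shows "T \<in> minimal_trees \<longleftrightarrow> no_tails P \<and> P \<noteq> Node () []"
proof -
  obtain L where L: "L \<in> embeddings T" "P = shape L" using assms(2) by blast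
  then have "subtrees L = [] \<longleftrightarrow> P = Node () []"
    by (cases L) simp
  with L minimal_trees_iff[OF assms(1) L(1)] show ?thesis by simp
qed

text \<open>Every tree has a shape and every plane tree is the shape of some tree. The naming is not
  injective: all shapes of a tree name its class.\<close>

lemma minimal_tree_classes_eq:
  "minimal_tree_classes = class_of ` {P. no_tails P \<and> P \<noteq> Node () []}"
proof -
  let ?R = "{(T, T'). T \<in> minimal_trees \<and> T' \<in> minimal_trees \<and> (\<exists>f. is_tree_iso f T T')}"
  have cls: "?R `` {T} = class_of P" if "T \<in> minimal_trees" "P \<in> shape ` embeddings T" for T P
    using that ex_tree_iso_iff[OF minimal_treesD minimal_treesD that(2)] by (auto simp: class_of_def)
  show ?thesis
  proof (intro equalityI subsetI)
    fix C assume "C \<in> minimal_tree_classes"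
    then obtain T where T: "T \<in> minimal_trees" "C = ?R `` {T}"
      by (auto simp: minimal_tree_classes_def quotient_def)
    obtain P where P: "P \<in> shape ` embeddings T"
      using ex_embedding[OF minimal_treesD[OF T(1)]] by blast
    with T minimal_trees_shape[OF minimal_treesD[OF T(1)] P] cls[OF T(1) P]
    show "C \<in> class_of ` {P. no_tails P \<and> P \<noteq> Node () []}" by blast
  next
    fix C assume "C \<in> class_of ` {P. no_tails P \<and> P \<noteq> Node () []}"
    then obtain P where P: "no_tails P" "P \<noteq> Node () []" "C = class_of P" by blast
    obtain T :: "nat tree" where T: "rooted_tree T" "P \<in> shape ` embeddings T"
      using ex_tree_with_shape by blast
    with P minimal_trees_shape have "T \<in> minimal_trees" by blast
    with cls[OF this T(2)] P(3) show "C \<in> minimal_tree_classes"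
      unfolding minimal_tree_classes_def quotient_def by blast
  qed
qed

text \<open>The last claim identifies the fibre of \<open>class_of\<close> with the shapes of the
  chosen representative, so that \<open>sum_weight_shapes\<close> evaluates the sum of weights over
  a fibre.\<close>

lemma class_of_representative:
  assumes "no_tails P" "P \<noteq> Node () []"
  defines "T \<equiv> SOME T. T \<in> class_of P"
  shows "T \<in> minimal_trees" "P \<in> shape ` embeddings T"
    "{Q. no_tails Q \<and> Q \<noteq> Node () [] \<and> class_of Q = class_of P} = shape ` embeddings T"
proof -
  have nonempty: "\<exists>T. T \<in> class_of Q" if "no_tails Q" "Q \<noteq> Node () []" for Q
    using that ex_tree_with_shape[of Q] minimal_trees_shape by (fastforce simp: class_of_def)
  have "T \<in> class_of P"
    unfolding T_def using nonempty[OF assms(1,2)] by (rule someI_ex)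
  then show T: "T \<in> minimal_trees" and P: "P \<in> shape ` embeddings T"
    by (auto simp: class_of_def)
  have "class_of Q = class_of P" if Q: "Q \<in> shape ` embeddings T" for Q
    using ex_tree_iso_iff[OF minimal_treesD[OF T] minimal_treesD P]
      ex_tree_iso_iff[OF minimal_treesD[OF T] minimal_treesD Q]
    by (auto simp only: class_of_def)
  moreover have "Q \<in> shape ` embeddings T" if "class_of Q = class_of P" for Q
    using \<open>T \<in> class_of P\<close> that by (auto simp: class_of_def)
  ultimately show "{Q. no_tails Q \<and> Q \<noteq> Node () [] \<and> class_of Q = class_of P} = shape ` embeddings T"
    using minimal_trees_shape[OF minimal_treesD[OF T]] T by blast
qed

lemma mcoeff_tree_term:
  assumes "rooted_tree T" "P \<in> shape ` embeddings T"
  shows "mcoeff (tree_term T) m =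
    (if monomial P 1 = m then \<Sum>Q \<in> shape ` embeddings T. weight Q else 0)"
  using assms(2) tree_term_eq[OF assms(1)]
  by (auto simp: sum_weight_shapes[OF assms(1)] mcoeff_const_mult mfps_monom_def simp del: One_nat_def)

lemma p_A_eq: "p_A = gen_series (\<lambda>P. monomial P 1) weight {P :: unit ptree. no_tails P}"
proof (rule mfps_eqI)
  fix m
  define rep where "rep C = (SOME T. T \<in> C)" for C :: "nat tree set"
  let ?G = "{P. no_tails P \<and> P \<noteq> Node () [] \<and> monomial P 1 = m}"
  have fin: "finite ?G"
  proof (rule finite_subset)
    show "?G \<subseteq> {P \<in> {P. no_tails P}. monomial P 1 = m}" by blast
    show "finite {P \<in> {P :: unit ptree. no_tails P}. monomial P 1 = m}"
      using locally_finite_no_tails[of 1] unfolding locally_finite_def by blast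
  qed
  have rep: "rooted_tree (rep (class_of P))" "P \<in> shape ` embeddings (rep (class_of P))"
    "{Q. no_tails Q \<and> Q \<noteq> Node () [] \<and> class_of Q = class_of P} = shape ` embeddings (rep (class_of P))"
    if "no_tails P" "P \<noteq> Node () []" for P
    using class_of_representative[OF that] minimal_treesD by (auto simp only: rep_def)
  have coeff: "mcoeff (tree_term (rep (class_of P))) m =
      (if monomial P 1 = m then \<Sum>Q \<in> shape ` embeddings (rep (class_of P)). weight Q else 0)"
    if "no_tails P" "P \<noteq> Node () []" for P
    by (rule mcoeff_tree_term[OF rep(1,2)[OF that]])
  have same: "monomial Q 1 = monomial P 1"
    if P: "no_tails P" "P \<noteq> Node () []" and Q: "Q \<in> shape ` embeddings (rep (class_of P))" for P Q
  proof -
    obtain K L where "K \<in> embeddings (rep (class_of P))" "P = shape K"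
      "L \<in> embeddings (rep (class_of P))" "Q = shape L"
      using rep(2)[OF P] Q by blast
    then show ?thesis
      using monomial_embedding[OF rep(1)[OF P]] by (simp del: One_nat_def)
  qed
  have nonzero: "(\<Sum>Q \<in> shape ` embeddings (rep (class_of P)). weight Q) \<noteq> 0"
    if "no_tails P" "P \<noteq> Node () []" for P
    using card_tree_aut_nonzero[OF rep(1)[OF that]] sum_weight_shapes[OF rep(1)[OF that]] by simp
  \<comment> \<open>\<open>mfps_sum\<close> keeps only nonzero coefficients. As the weights of a
    class have nonzero sum, the classes kept are those with monomial \<open>m\<close>.\<close>
  have classes: "{C \<in> minimal_tree_classes. mcoeff (tree_term (rep C)) m \<noteq> 0} = class_of ` ?G"
    unfolding minimal_tree_classes_eq using coeff nonzero by (auto split: if_splits)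
  have "mcoeff p_A m = (if m = {#} then 1 else 0) + (\<Sum>C \<in> class_of ` ?G. mcoeff (tree_term (rep C)) m)"
    using classes by (simp add: p_A_def plus_mfps_def one_mfps_def mfps_sum_def rep_def)
  also have "(\<Sum>C \<in> class_of ` ?G. mcoeff (tree_term (rep C)) m) =
      (\<Sum>C \<in> class_of ` ?G. \<Sum>Q \<in> {Q \<in> ?G. class_of Q = C}. weight Q)"
  proof (rule sum.cong)
    fix C assume "C \<in> class_of ` ?G"
    then obtain P where P: "no_tails P" "P \<noteq> Node () []" "monomial P 1 = m" "C = class_of P" by blast
    \<comment> \<open>All shapes of the representative share one monomial, so the restriction to
      monomial \<open>m\<close> removes none of the fibre.\<close>
    have "{Q \<in> ?G. class_of Q = C} = shape ` embeddings (rep (class_of P))"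
      using rep(3)[OF P(1,2)] same[OF P(1,2)] P(3,4) by blast
    then show "mcoeff (tree_term (rep C)) m = (\<Sum>Q \<in> {Q \<in> ?G. class_of Q = C}. weight Q)"
      using coeff[OF P(1,2)] P(3,4) by simp
  qed simp
  also have "\<dots> = (\<Sum>Q \<in> ?G. weight Q)"
    by (rule sum.image_gen[OF fin, symmetric])
  \<comment> \<open>The constant 1 is the single leaf, of empty monomial and weight 1, which
    \<open>?G\<close> leaves out.\<close>
  also have "(if m = {#} then 1 else 0) + \<dots> = (\<Sum>Q \<in> {P \<in> {P :: unit ptree. no_tails P}. monomial P 1 = m}. weight Q)"
  proof (cases "m = {#}")
    case True
    then have "{P \<in> {P :: unit ptree. no_tails P}. monomial P 1 = m} = insert (Node () []) ?G"
      by (auto simp del: One_nat_def)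
    then show ?thesis using True fin by simp
  next
    case False
    then have "{P \<in> {P :: unit ptree. no_tails P}. monomial P 1 = m} = ?G"
      by (auto simp del: One_nat_def)
    then show ?thesis using False by simp
  qed
  finally show "mcoeff p_A m = mcoeff (gen_series (\<lambda>P. monomial P 1) weight {P :: unit ptree. no_tails P}) m"
    by (simp only: mcoeff_gen_series)
qed

section \<open>The recursion\<close>

text \<open>
  The list consisting of a single leaf is matched with the leaf itself, since the tree whose root
  has a leaf as its only child is a trivial tail.
\<close>

lemma bij_betw_no_tails:
  "bij_betw (\<lambda>Ps. if Ps = [Node () []] then Node () [] else Node () Ps)
    (lists {P. no_tails P} - {[]}) {P. no_tails P}"
    (is "bij_betw ?f (lists ?G - {[]}) ?G")
proof (rule bij_betw_byWitness)
  let ?g = "\<lambda>P :: unit ptree. if P = Node () [] then [Node () []] else subtrees P"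
  show "\<forall>Ps \<in> lists ?G - {[]}. ?g (?f Ps) = Ps" by auto
  show "\<forall>P \<in> ?G. ?f (?g P) = P"
  proof
    fix P assume "P \<in> ?G"
    then show "?f (?g P) = P"
      by (cases P) (auto simp: no_tails_Node simp del: no_tails.simps)
  qed
  show "?f ` (lists ?G - {[]}) \<subseteq> ?G"
    by (auto simp: no_tails_Node in_lists_conv_set simp del: no_tails.simps)
  show "?g ` ?G \<subseteq> lists ?G - {[]}"
  proof
    fix Ps assume "Ps \<in> ?g ` ?G"
    then obtain P where P: "no_tails P" "Ps = ?g P" by blast
    obtain Qs where "P = Node () Qs" by (cases P) simp
    with P show "Ps \<in> lists ?G - {[]}"
      by (auto simp: no_tails_Node in_lists_conv_set simp del: no_tails.simps)
  qed
qed

lemma exp_minus_1_eq: "mfps_exp (mfps_var 1 * mfps_rename Suc p_A) - 1 = mfps_var 1 * p_A"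
proof -
  let ?G = "{P :: unit ptree. no_tails P}"
  define d where "d Ps = replicate_mset (length Ps) 1 + (\<Sum>P \<leftarrow> Ps. monomial P 2)"
    for Ps :: "unit ptree list"
  let ?c = "\<lambda>Ps. 1 / fact (length Ps) * prod_list (map weight Ps)"
  have "mfps_rename Suc p_A = gen_series (\<lambda>P. image_mset Suc (monomial P 1)) weight ?G"
    unfolding p_A_eq by (rule mfps_rename_gen_series[OF inj_Suc locally_finite_no_tails])
  then have "mfps_rename Suc p_A = gen_series (\<lambda>P. monomial P 2) weight ?G"
    by (simp add: numeral_2_eq_2 monomial_shift)
  then have "mfps_exp (mfps_var 1 * mfps_rename Suc p_A) = gen_series d ?c (lists ?G)"
    unfolding d_def by (simp only: mfps_exp_var_mult_gen_series[OF locally_finite_no_tails])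
  \<comment> \<open>A list of \<open>k\<close> trees carries at least \<open>k\<close> copies of the
    variable 1, so the empty list alone has empty monomial, and subtracting 1 removes it.\<close>
  also have "\<dots> - 1 = gen_series d ?c (lists ?G - {[]})"
  proof (rule mfps_eqI)
    fix m
    show "mcoeff (gen_series d ?c (lists ?G) - 1) m = mcoeff (gen_series d ?c (lists ?G - {[]})) m"
    proof (cases "m = {#}")
      case True
      have "d Ps = {#} \<longleftrightarrow> Ps = []" for Ps :: "unit ptree list"
        by (cases Ps) (simp_all add: d_def)
      then have sets: "{Ps \<in> lists ?G. d Ps = m} = {[]}" "{Ps \<in> lists ?G - {[]}. d Ps = m} = {}"
        using True by auto
      show ?thesis
        unfolding minus_mfps_def one_mfps_def mcoeff_Abs mcoeff_gen_series sets
        by (simp add: True)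
    next
      case False
      then have "{Ps \<in> lists ?G - {[]}. d Ps = m} = {Ps \<in> lists ?G. d Ps = m}"
        by (auto simp: d_def)
      with False show ?thesis
        by (simp add: minus_mfps_def one_mfps_def mcoeff_gen_series)
    qed
  qed
  \<comment> \<open>A list of \<open>k\<close> children carries \<open>k\<close> copies of the
    variable 1 for itself, the root of its tree only \<open>k - 1\<close>; the surplus is
    \<open>{#1#}\<close>. For the list with one leaf the monomial is \<open>{#1#}\<close> and that
    of its partner, the leaf, is empty, so the same factor fits.\<close>
  also have "\<dots> = gen_series (\<lambda>P. {#1#} + monomial P 1) weight ?G"
  proof (rule gen_series_reindex[OF bij_betw_no_tails])
    fix Ps :: "unit ptree list" assume "Ps \<in> lists ?G - {[]}"
    then obtain P Qs where Ps: "Ps = P # Qs" by (cases Ps) auto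
    show "d Ps = {#1#} + monomial (if Ps = [Node () []] then Node () [] else Node () Ps) 1"
      by (simp add: Ps d_def numeral_2_eq_2)
    show "?c Ps = weight (if Ps = [Node () []] then Node () [] else Node () Ps)"
      by simp
  qed
  also have "\<dots> = mfps_var 1 * p_A"
    by (simp only: p_A_eq mfps_var_eq_monom mfps_monom_mult_gen_series)
  finally show ?thesis .
qed

text \<open>Divisibility ensures that the definite description in the quotient denotes an actual
  quotient; both claims follow once the numerator is recognised as the variable times
  \<open>p_A\<close>.\<close>

theorem theorem3p2:
  "mfps_var 1 dvd mfps_exp (mfps_var 1 * mfps_rename Suc p_A) - 1 \<and>
   p_A = mfps_quotient (mfps_exp (mfps_var 1 * mfps_rename Suc p_A) - 1) (mfps_var 1)"
  unfolding exp_minus_1_eq mfps_quotient_var by simp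

end
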